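(* Let $k$ be a field, $V$ a $k$-vector space and $A=T(V)/(R)$ a quadratic algebra with $R\subseteq V\otimes V$. For any Koszul chain $z$ with coefficients in any $A$-bimodule $M$ (that is, any $z\in M\otimes W_q$, $q\ge0$), the following formula holds: $$[e_A,z]_{\frown_K}=-b_K(z).$$
   Context: $W_0=k$, $W_1=V$, $W_p=\bigcap_{i+2+j=p}V^{\otimes i}\otimes R\otimes V^{\otimes j}\subseteq V^{\otimes p}$ for $p\ge2$. Elements of $W_p$ are written $x_1\ldots x_p$ (a sum of such tensors, $x_i\in V$), with the same notation when $W_p$ is viewed inside $V^{\otimes q}\otimes W_r\otimes V^{\otimes s}$, $q+r+s=p$. Koszul $q$-chains with coefficients in an $A$-bimodule $M$ are the elements of $M\otimes W_q$, with differential $b_K(m\otimes x_1\ldots x_q)=m.x_1\otimes x_2\ldots x_q+(-1)^qx_q.m\otimes x_1\ldots x_{q-1}$ (and $b_K=0$ on $M\otimes W_0$). For a Koszul $p$-cochain $f:W_p\to P$ ($P$ a bimodule) and $z=m\otimes x_1\ldots x_q\in M\otimes W_q$, the Koszul cap products are $f\frown_Kz=(-1)^{(q-p)p}(f(x_{q-p+1}\ldots x_q)\otimes_Am)\otimes x_1\ldots x_{q-p}$ and $z\frown_Kf=(-1)^{pq}(m\otimes_Af(x_1\ldots x_p))\otimes x_{p+1}\ldots x_q$, both being $0$ if $q<p$. If $M$ or $P$ equals $A$ (identifying $A\otimes_AM\cong M\cong M\otimes_AA$), the Koszul cap bracket is $[f,z]_{\frown_K}=f\frown_Kz-(-1)^{pq}z\frown_Kf$.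 $e_A:V\to A$ is the $1$-cochain $e_A(x)=x$ for $x\in V$. *)

theory Defs
  imports
    "HOL-Algebra.QuotRing"
    "HOL-Algebra.Module"
    "HOL-Algebra.Free_Abelian_Groups"
    "HOL-Algebra.Algebraic_Closure_Type"
begin

text \<open>
  The ground field is a type \<open>'k\<close> of class \<open>field\<close>, regarded as the ring record
  \<open>ring_of_type_algebra\<close>.  The vector space \<open>V\<close> and the coefficient bimodule \<open>M\<close> are
  carrier-based modules over it, since \<open>T(V)\<close> and \<open>A\<close> depend on \<open>V\<close> and \<open>R\<close> and hence cannot
  be types (and \<open>M = A\<close> should be an instance).
\<close>

abbreviation base_field :: "'k::field ring"
  where "base_field \<equiv> ring_of_type_algebra"


section \<open>The tensor algebra\<close>

text \<open>Words form a monoid, so that \<open>'v list \<Rightarrow>\<^sub>0 'k\<close> is the free associative unital algebra on \<open>'v\<close>.\<close>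

instantiation list :: (type) monoid_add
begin

definition zero_list :: "'a list" where "zero_list = []"

definition plus_list :: "'a list \<Rightarrow> 'a list \<Rightarrow> 'a list" where "plus_list xs ys = xs @ ys"

instance by standard (simp_all add: zero_list_def plus_list_def)

end

definition free_algebra :: "('k::field, 'v, 'b) module_scheme \<Rightarrow> ('v list \<Rightarrow>\<^sub>0 'k) ring"
  where "free_algebra V =
    ring_of_type_algebra \<lparr>carrier := {p. Poly_Mapping.keys p \<subseteq> lists (carrier V)}\<rparr>"

text \<open>Dividing by these relations makes the generators \<open>[x]\<close> depend linearly on \<open>x \<in> V\<close>, hence
  makes words multilinear in their letters.\<close>

definition linearity_ideal :: "('k::field, 'v, 'b) module_scheme \<Rightarrow> ('v list \<Rightarrow>\<^sub>0 'k) set"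
  where "linearity_ideal V = Idl\<^bsub>free_algebra V\<^esub>
    ({Poly_Mapping.single [x \<oplus>\<^bsub>V\<^esub> y] 1 - Poly_Mapping.single [x] 1 - Poly_Mapping.single [y] 1
        | x y. x \<in> carrier V \<and> y \<in> carrier V}
     \<union> {Poly_Mapping.single [c \<odot>\<^bsub>V\<^esub> x] 1 - Poly_Mapping.single [x] c | c x. x \<in> carrier V})"

definition tensor_class ::
    "('k::field, 'v, 'b) module_scheme \<Rightarrow> ('v list \<Rightarrow>\<^sub>0 'k) \<Rightarrow> ('v list \<Rightarrow>\<^sub>0 'k) set"
  where "tensor_class V p = linearity_ideal V +>\<^bsub>free_algebra V\<^esub> p"

definition tensor_algebra ::
    "('k::field, 'v, 'b) module_scheme \<Rightarrow> ('k, ('v list \<Rightarrow>\<^sub>0 'k) set) module"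
  where "tensor_algebra V =
    (let T = free_algebra V Quot linearity_ideal V
     in ring.extend T
          (module.fields (\<lambda>c t. tensor_class V (Poly_Mapping.single [] c) \<otimes>\<^bsub>T\<^esub> t)))"

text \<open>\<open>tensor_word V [x\<^sub>1, \<dots>, x\<^sub>n]\<close> is the pure tensor \<open>x\<^sub>1 \<otimes> \<dots> \<otimes> x\<^sub>n\<close>; it is the unit
  of \<open>T(V)\<close> for \<open>n = 0\<close>.\<close>

definition tensor_word ::
    "('k::field, 'v, 'b) module_scheme \<Rightarrow> 'v list \<Rightarrow> ('v list \<Rightarrow>\<^sub>0 'k) set"
  where "tensor_word V xs = tensor_class V (Poly_Mapping.single xs 1)"

text \<open>\<open>V\<^sup>\<otimes>\<^sup>n\<close>, as the homogeneous component of degree \<open>n\<close> of \<open>T(V)\<close>.\<close>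

definition tensor_power ::
    "('k::field, 'v, 'b) module_scheme \<Rightarrow> nat \<Rightarrow> ('v list \<Rightarrow>\<^sub>0 'k) set set"
  where "tensor_power V n =
    tensor_class V ` {p \<in> carrier (free_algebra V). \<forall>xs \<in> Poly_Mapping.keys p. length xs = n}"


section \<open>Quadratic algebras and the spaces \<open>W\<^sub>p\<close>\<close>

definition quadratic_relations ::
    "('k::field, 'v, 'b) module_scheme \<Rightarrow> ('v list \<Rightarrow>\<^sub>0 'k) set set \<Rightarrow> bool"
  where "quadratic_relations V R \<longleftrightarrow>
    R \<subseteq> tensor_power V 2 \<and> submodule R base_field (tensor_algebra V)"

definition algebra_class ::
    "('k::field, 'v, 'b) module_scheme \<Rightarrow> ('v list \<Rightarrow>\<^sub>0 'k) set set
      \<Rightarrow> ('v list \<Rightarrow>\<^sub>0 'k) set \<Rightarrow> ('v list \<Rightarrow>\<^sub>0 'k) set set"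
  where "algebra_class V R t = Idl\<^bsub>tensor_algebra V\<^esub> R +>\<^bsub>tensor_algebra V\<^esub> t"

definition quadratic_algebra ::
    "('k::field, 'v, 'b) module_scheme \<Rightarrow> ('v list \<Rightarrow>\<^sub>0 'k) set set
      \<Rightarrow> ('k, ('v list \<Rightarrow>\<^sub>0 'k) set set) module"
  where "quadratic_algebra V R =
    (let T = tensor_algebra V; A = T Quot (Idl\<^bsub>T\<^esub> R)
     in ring.extend A
          (module.fields (\<lambda>c a. algebra_class V R (c \<odot>\<^bsub>T\<^esub> \<one>\<^bsub>T\<^esub>) \<otimes>\<^bsub>A\<^esub> a)))"

text \<open>The subspace \<open>V\<^sup>\<otimes>\<^sup>i \<otimes> R \<otimes> V\<^sup>\<otimes>\<^sup>j\<close> of \<open>V\<^sup>\<otimes>\<^sup>(\<^sup>i\<^sup>+\<^sup>2\<^sup>+\<^sup>j\<^sup>)\<close>.  The products below are stable under scalars,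
  so the additive subgroup they generate is their linear span.\<close>

definition relation_space ::
    "('k::field, 'v, 'b) module_scheme \<Rightarrow> ('v list \<Rightarrow>\<^sub>0 'k) set set
      \<Rightarrow> nat \<Rightarrow> nat \<Rightarrow> ('v list \<Rightarrow>\<^sub>0 'k) set set"
  where "relation_space V R i j = generate (add_monoid (tensor_algebra V))
    {u \<otimes>\<^bsub>tensor_algebra V\<^esub> r \<otimes>\<^bsub>tensor_algebra V\<^esub> v
      | u r v. u \<in> tensor_power V i \<and> r \<in> R \<and> v \<in> tensor_power V j}"

definition koszul_space ::
    "('k::field, 'v, 'b) module_scheme \<Rightarrow> ('v list \<Rightarrow>\<^sub>0 'k) set set
      \<Rightarrow> nat \<Rightarrow> ('v list \<Rightarrow>\<^sub>0 'k) set set"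
  where "koszul_space V R p =
    (if p < 2 then tensor_power V p
     else (\<Inter>(i, j) \<in> {(i, j). i + 2 + j = p}. relation_space V R i j))"


section \<open>Bimodules\<close>

text \<open>Bimodules over a \<open>k\<close>-algebra, on which \<open>k\<close> acts in the same way from both sides.\<close>

locale algebra_bimodule = A: ring A + M: module base_field M
  for A :: "('k::field, 'a, 'c) module_scheme"
    and M :: "('k, 'm, 'd) module_scheme"
    and lact :: "'a \<Rightarrow> 'm \<Rightarrow> 'm"
    and ract :: "'m \<Rightarrow> 'a \<Rightarrow> 'm" +
  assumes lact_closed: "a \<in> carrier A \<Longrightarrow> m \<in> carrier M \<Longrightarrow> lact a m \<in> carrier M"
    and ract_closed: "a \<in> carrier A \<Longrightarrow> m \<in> carrier M \<Longrightarrow> ract m a \<in> carrier M"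
    and lact_add_left: "a \<in> carrier A \<Longrightarrow> b \<in> carrier A \<Longrightarrow> m \<in> carrier M \<Longrightarrow>
          lact (a \<oplus>\<^bsub>A\<^esub> b) m = lact a m \<oplus>\<^bsub>M\<^esub> lact b m"
    and lact_add_right: "a \<in> carrier A \<Longrightarrow> m \<in> carrier M \<Longrightarrow> n \<in> carrier M \<Longrightarrow>
          lact a (m \<oplus>\<^bsub>M\<^esub> n) = lact a m \<oplus>\<^bsub>M\<^esub> lact a n"
    and ract_add_left: "a \<in> carrier A \<Longrightarrow> m \<in> carrier M \<Longrightarrow> n \<in> carrier M \<Longrightarrow>
          ract (m \<oplus>\<^bsub>M\<^esub> n) a = ract m a \<oplus>\<^bsub>M\<^esub> ract n a"
    and ract_add_right: "a \<in> carrier A \<Longrightarrow> b \<in> carrier A \<Longrightarrow> m \<in> carrier M \<Longrightarrow>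
          ract m (a \<oplus>\<^bsub>A\<^esub> b) = ract m a \<oplus>\<^bsub>M\<^esub> ract m b"
    and lact_mult: "a \<in> carrier A \<Longrightarrow> b \<in> carrier A \<Longrightarrow> m \<in> carrier M \<Longrightarrow>
          lact (a \<otimes>\<^bsub>A\<^esub> b) m = lact a (lact b m)"
    and ract_mult: "a \<in> carrier A \<Longrightarrow> b \<in> carrier A \<Longrightarrow> m \<in> carrier M \<Longrightarrow>
          ract m (a \<otimes>\<^bsub>A\<^esub> b) = ract (ract m a) b"
    and lact_ract: "a \<in> carrier A \<Longrightarrow> b \<in> carrier A \<Longrightarrow> m \<in> carrier M \<Longrightarrow>
          ract (lact a m) b = lact a (ract m b)"
    and lact_scalar: "m \<in> carrier M \<Longrightarrow> lact (c \<odot>\<^bsub>A\<^esub> \<one>\<^bsub>A\<^esub>) m = c \<odot>\<^bsub>M\<^esub> m"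
    and ract_scalar: "m \<in> carrier M \<Longrightarrow> ract m (c \<odot>\<^bsub>A\<^esub> \<one>\<^bsub>A\<^esub>) = c \<odot>\<^bsub>M\<^esub> m"
    \<comment> \<open>for \<open>c = 1\<close> these two laws give unitality\<close>


section \<open>Tensor products over the ground field\<close>

definition tensor_relations ::
    "('k, 'm, 'c) module_scheme \<Rightarrow> ('k, 'n, 'd) module_scheme \<Rightarrow> ('m \<times> 'n \<Rightarrow>\<^sub>0 int) set"
  where "tensor_relations M N =
    generate (free_Abelian_group (carrier M \<times> carrier N))
     ({frag_of (m \<oplus>\<^bsub>M\<^esub> m', n) - frag_of (m, n) - frag_of (m', n)
        | m m' n. m \<in> carrier M \<and> m' \<in> carrier M \<and> n \<in> carrier N}
      \<union> {frag_of (m, n \<oplus>\<^bsub>N\<^esub> n') - frag_of (m, n) - frag_of (m, n')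
        | m n n'. m \<in> carrier M \<and> n \<in> carrier N \<and> n' \<in> carrier N}
      \<union> {frag_of (c \<odot>\<^bsub>M\<^esub> m, n) - frag_of (m, c \<odot>\<^bsub>N\<^esub> n)
        | c m n. m \<in> carrier M \<and> n \<in> carrier N})"

text \<open>The abelian group \<open>M \<otimes>\<^sub>k N\<close>, in the additive notation of ring records; the multiplicative
  fields of the record are irrelevant.\<close>

definition tensor_product ::
    "('k, 'm, 'c) module_scheme \<Rightarrow> ('k, 'n, 'd) module_scheme \<Rightarrow> ('m \<times> 'n \<Rightarrow>\<^sub>0 int) set ring"
  where "tensor_product M N =
    (let G = free_Abelian_group (carrier M \<times> carrier N) Mod tensor_relations M N
     in \<lparr>carrier = carrier G, monoid.mult = undefined, one = undefined,
         zero = \<one>\<^bsub>G\<^esub>, add = monoid.mult G\<rparr>)"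

definition pure_tensor ::
    "('k, 'm, 'c) module_scheme \<Rightarrow> ('k, 'n, 'd) module_scheme \<Rightarrow> 'm \<Rightarrow> 'n \<Rightarrow> ('m \<times> 'n \<Rightarrow>\<^sub>0 int) set"
  where "pure_tensor M N m n =
    tensor_relations M N #>\<^bsub>free_Abelian_group (carrier M \<times> carrier N)\<^esub> frag_of (m, n)"

text \<open>\<open>additive_extension C S g h z\<close> is the value at \<open>z\<close> of the additive map determined by
  \<open>g s \<mapsto> h s\<close> (\<open>s \<in> S\<close>) on the subgroup of \<open>C\<close> generated by the elements \<open>g s\<close>.  It is used to
  define maps by formulas on tensors, and is meaningful when \<open>z\<close> lies in that subgroup and the
  map is well defined.\<close>

definition additive_extension ::
    "('c, 'b) ring_scheme \<Rightarrow> 's set \<Rightarrow> ('s \<Rightarrow> 'c) \<Rightarrow> ('s \<Rightarrow> 'c) \<Rightarrow> 'c \<Rightarrow> 'c"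
  where "additive_extension C S g h z =
    (THE y. \<exists>\<phi> \<in> hom (subgroup_generated (add_monoid C) (g ` S)) (add_monoid C).
        (\<forall>s \<in> S. \<phi> (g s) = h s) \<and> y = \<phi> z)"


section \<open>Koszul chains\<close>

text \<open>All chains live in \<open>M \<otimes> T(V)\<close>.  As \<open>k\<close> is a field, \<open>M \<otimes> W\<^sub>q\<close> embeds there as the span of
  the tensors \<open>m \<otimes> w\<close> with \<open>w \<in> W\<^sub>q\<close>.\<close>

abbreviation chain_group ::
    "('k::field, 'v, 'b) module_scheme \<Rightarrow> ('k, 'm, 'd) module_scheme
      \<Rightarrow> ('m \<times> ('v list \<Rightarrow>\<^sub>0 'k) set \<Rightarrow>\<^sub>0 int) set ring"
  where "chain_group V M \<equiv> tensor_product M (tensor_algebra V)"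

abbreviation chain_tensor ::
    "('k::field, 'v, 'b) module_scheme \<Rightarrow> ('k, 'm, 'd) module_scheme
      \<Rightarrow> 'm \<Rightarrow> ('v list \<Rightarrow>\<^sub>0 'k) set \<Rightarrow> ('m \<times> ('v list \<Rightarrow>\<^sub>0 'k) set \<Rightarrow>\<^sub>0 int) set"
  where "chain_tensor V M \<equiv> pure_tensor M (tensor_algebra V)"

definition koszul_chains ::
    "('k::field, 'v, 'b) module_scheme \<Rightarrow> ('v list \<Rightarrow>\<^sub>0 'k) set set
      \<Rightarrow> ('k, 'm, 'd) module_scheme \<Rightarrow> nat \<Rightarrow> ('m \<times> ('v list \<Rightarrow>\<^sub>0 'k) set \<Rightarrow>\<^sub>0 int) set set"
  where "koszul_chains V R M q = generate (add_monoid (chain_group V M))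
    {chain_tensor V M m w | m w. m \<in> carrier M \<and> w \<in> koszul_space V R q}"

text \<open>The formula for \<open>b\<^sub>K\<close> is imposed on all \<open>m \<otimes> x\<^sub>1\<dots>x\<^sub>q\<close> in \<open>M \<otimes> V\<^sup>\<otimes>\<^sup>q\<close>, which contains
  \<open>M \<otimes> W\<^sub>q\<close>.\<close>

definition koszul_differential ::
    "('k::field, 'v, 'b) module_scheme \<Rightarrow> ('v list \<Rightarrow>\<^sub>0 'k) set set \<Rightarrow> ('k, 'm, 'd) module_scheme
      \<Rightarrow> (('v list \<Rightarrow>\<^sub>0 'k) set set \<Rightarrow> 'm \<Rightarrow> 'm) \<Rightarrow> ('m \<Rightarrow> ('v list \<Rightarrow>\<^sub>0 'k) set set \<Rightarrow> 'm)
      \<Rightarrow> nat \<Rightarrow> ('m \<times> ('v list \<Rightarrow>\<^sub>0 'k) set \<Rightarrow>\<^sub>0 int) set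
      \<Rightarrow> ('m \<times> ('v list \<Rightarrow>\<^sub>0 'k) set \<Rightarrow>\<^sub>0 int) set"
  where "koszul_differential V R M lact ract q z =
    (if q = 0 then \<zero>\<^bsub>chain_group V M\<^esub>
     else additive_extension (chain_group V M)
       {(m, xs). m \<in> carrier M \<and> xs \<in> lists (carrier V) \<and> length xs = q}
       (\<lambda>(m, xs). chain_tensor V M m (tensor_word V xs))
       (\<lambda>(m, xs).
          chain_tensor V M (ract m (algebra_class V R (tensor_word V [hd xs])))
            (tensor_word V (tl xs))
          \<oplus>\<^bsub>chain_group V M\<^esub>
          [((-1 :: int) ^ q)] \<cdot>\<^bsub>chain_group V M\<^esub>
            chain_tensor V M (lact (algebra_class V R (tensor_word V [last xs])) m)
              (tensor_word V (butlast xs)))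
       z)"


section \<open>Koszul cap products with \<open>A\<close>-valued cochains\<close>

text \<open>Here \<open>f : W\<^sub>p \<rightarrow> A\<close>, and \<open>A \<otimes>\<^sub>A M\<close> and \<open>M \<otimes>\<^sub>A A\<close> are identified with \<open>M\<close> through the
  actions \<open>a \<otimes> m \<mapsto> a.m\<close> and \<open>m \<otimes> a \<mapsto> m.a\<close>.  As \<open>f\<close> is defined only on \<open>W\<^sub>p\<close>, the space
  \<open>W\<^sub>q\<close> is viewed inside \<open>V\<^sup>\<otimes>\<^sup>(\<^sup>q\<^sup>-\<^sup>p\<^sup>) \<otimes> W\<^sub>p\<close> (left cap), respectively \<open>W\<^sub>p \<otimes> V\<^sup>\<otimes>\<^sup>(\<^sup>q\<^sup>-\<^sup>p\<^sup>)\<close>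
  (right cap): in the products below \<open>w \<in> W\<^sub>p\<close> is the block of factors to which \<open>f\<close> is applied
  and \<open>u\<close> is the block of the remaining ones.\<close>

definition koszul_cap_left ::
    "('k::field, 'v, 'b) module_scheme \<Rightarrow> ('v list \<Rightarrow>\<^sub>0 'k) set set \<Rightarrow> ('k, 'm, 'd) module_scheme
      \<Rightarrow> (('v list \<Rightarrow>\<^sub>0 'k) set set \<Rightarrow> 'm \<Rightarrow> 'm)
      \<Rightarrow> nat \<Rightarrow> (('v list \<Rightarrow>\<^sub>0 'k) set \<Rightarrow> ('v list \<Rightarrow>\<^sub>0 'k) set set)
      \<Rightarrow> nat \<Rightarrow> ('m \<times> ('v list \<Rightarrow>\<^sub>0 'k) set \<Rightarrow>\<^sub>0 int) set
      \<Rightarrow> ('m \<times> ('v list \<Rightarrow>\<^sub>0 'k) set \<Rightarrow>\<^sub>0 int) set"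
  where "koszul_cap_left V R M lact p f q z =
    (if q < p then \<zero>\<^bsub>chain_group V M\<^esub>
     else additive_extension (chain_group V M)
       {(m, u, w). m \<in> carrier M \<and> u \<in> tensor_power V (q - p) \<and> w \<in> koszul_space V R p}
       (\<lambda>(m, u, w). chain_tensor V M m (u \<otimes>\<^bsub>tensor_algebra V\<^esub> w))
       (\<lambda>(m, u, w). [((-1 :: int) ^ ((q - p) * p))] \<cdot>\<^bsub>chain_group V M\<^esub>
          chain_tensor V M (lact (f w) m) u)
       z)"

definition koszul_cap_right ::
    "('k::field, 'v, 'b) module_scheme \<Rightarrow> ('v list \<Rightarrow>\<^sub>0 'k) set set \<Rightarrow> ('k, 'm, 'd) module_scheme
      \<Rightarrow> ('m \<Rightarrow> ('v list \<Rightarrow>\<^sub>0 'k) set set \<Rightarrow> 'm)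
      \<Rightarrow> nat \<Rightarrow> (('v list \<Rightarrow>\<^sub>0 'k) set \<Rightarrow> ('v list \<Rightarrow>\<^sub>0 'k) set set)
      \<Rightarrow> nat \<Rightarrow> ('m \<times> ('v list \<Rightarrow>\<^sub>0 'k) set \<Rightarrow>\<^sub>0 int) set
      \<Rightarrow> ('m \<times> ('v list \<Rightarrow>\<^sub>0 'k) set \<Rightarrow>\<^sub>0 int) set"
  where "koszul_cap_right V R M ract p f q z =
    (if q < p then \<zero>\<^bsub>chain_group V M\<^esub>
     else additive_extension (chain_group V M)
       {(m, w, u). m \<in> carrier M \<and> w \<in> koszul_space V R p \<and> u \<in> tensor_power V (q - p)}
       (\<lambda>(m, w, u). chain_tensor V M m (w \<otimes>\<^bsub>tensor_algebra V\<^esub> u))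
       (\<lambda>(m, w, u). [((-1 :: int) ^ (p * q))] \<cdot>\<^bsub>chain_group V M\<^esub>
          chain_tensor V M (ract m (f w)) u)
       z)"

text \<open>The bracket \<open>[f, z]\<close> of a \<open>p\<close>-cochain \<open>f\<close> and a \<open>q\<close>-chain \<open>z\<close>.\<close>

definition koszul_cap_bracket ::
    "('k::field, 'v, 'b) module_scheme \<Rightarrow> ('v list \<Rightarrow>\<^sub>0 'k) set set \<Rightarrow> ('k, 'm, 'd) module_scheme
      \<Rightarrow> (('v list \<Rightarrow>\<^sub>0 'k) set set \<Rightarrow> 'm \<Rightarrow> 'm) \<Rightarrow> ('m \<Rightarrow> ('v list \<Rightarrow>\<^sub>0 'k) set set \<Rightarrow> 'm)
      \<Rightarrow> nat \<Rightarrow> (('v list \<Rightarrow>\<^sub>0 'k) set \<Rightarrow> ('v list \<Rightarrow>\<^sub>0 'k) set set)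
      \<Rightarrow> nat \<Rightarrow> ('m \<times> ('v list \<Rightarrow>\<^sub>0 'k) set \<Rightarrow>\<^sub>0 int) set
      \<Rightarrow> ('m \<times> ('v list \<Rightarrow>\<^sub>0 'k) set \<Rightarrow>\<^sub>0 int) set"
  where "koszul_cap_bracket V R M lact ract p f q z =
    koszul_cap_left V R M lact p f q z
    \<ominus>\<^bsub>chain_group V M\<^esub>
    [((-1 :: int) ^ (p * q))] \<cdot>\<^bsub>chain_group V M\<^esub> koszul_cap_right V R M ract p f q z"

text \<open>The \<open>1\<close>-cochain \<open>e\<^sub>A : W\<^sub>1 = V \<rightarrow> A\<close> sending \<open>x\<close> to its class in \<open>A = T(V)/(R)\<close>.\<close>

definition fundamental_cochain ::
    "('k::field, 'v, 'b) module_scheme \<Rightarrow> ('v list \<Rightarrow>\<^sub>0 'k) set set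
      \<Rightarrow> ('v list \<Rightarrow>\<^sub>0 'k) set \<Rightarrow> ('v list \<Rightarrow>\<^sub>0 'k) set set"
  where "fundamental_cochain V R = restrict (algebra_class V R) (koszul_space V R 1)"

end

theory Submission
  imports Defs
begin

text \<open>
  On \<open>M \<otimes> T(V)\<close> contract the first, respectively the last, letter against \<open>m\<close>:
  \<open>\<rho> (m \<otimes> xw) = m.x \<otimes> w\<close> and \<open>\<kappa> (m \<otimes> wx) = x.m \<otimes> w\<close>.  On \<open>q\<close>-chains with \<open>q \<ge> 1\<close> one has
  \<open>e\<^sub>A \<frown> z = (-1)\<^sup>q\<^sup>-\<^sup>1 \<kappa> z\<close>, \<open>z \<frown> e\<^sub>A = (-1)\<^sup>q \<rho> z\<close> and \<open>b\<^sub>K z = \<rho> z + (-1)\<^sup>q \<kappa> z\<close>, and the formula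
  is a comparison of signs.  The substance is that \<open>\<rho>\<close> and \<open>\<kappa>\<close> exist, since otherwise
  \<^const>\<open>additive_extension\<close> would be a junk value: this is the universal property of
  \<open>M \<otimes> T(V)\<close> for maps that are linear in \<open>m\<close> and in every letter.
\<close>

section \<open>Abelian groups and rings\<close>

text \<open>The value of \<open>additive_extension\<close> at \<open>z\<close> is determined as soon
  as one homomorphism meets the prescribed formula on all generators: homomorphisms that agree on
  generators agree on the subgroup they generate. The two cap products and the differential are
  prescribed on different generating sets. For \<open>q \<ge> 1\<close> each of these sets contains
  the tensors of \<open>m\<close> with words of length \<open>q\<close>, and these already generate
  a subgroup containing the Koszul chains.

  Two quotients separate a formula on words from a map on the tensor product: the free algebra
  modulo the linearity ideal, and the free Abelian group on pairs modulo the tensor relations. No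
  basis of \<open>V\<close> is chosen, so a formula has to be checked against the relations of both.
  The target is a bare abelian group without scalars, hence coefficients are always carried by
  \<open>m\<close>. In degree 0 there is no letter to contract, and both contractions are set to
  zero there.\<close>

lemma (in abelian_group) idempotent_zero: "x \<in> carrier G \<Longrightarrow> x \<oplus> x = x \<Longrightarrow> x = \<zero>"
  by (metis add.r_cancel_one')

text \<open>The image of an additivity relator has this shape, both for the tensor relations and for
  the linearity ideal.\<close>

lemma (in abelian_group) add_minus_minus:
  "x \<in> carrier G \<Longrightarrow> y \<in> carrier G \<Longrightarrow> x \<oplus> y \<ominus> x \<ominus> y = \<zero>"
  by (simp add: minus_eq a_comm[of x y] a_assoc r_neg)

lemma (in abelian_group) hom_add:
  assumes "\<phi> \<in> hom (add_monoid G) (add_monoid G)" "\<psi> \<in> hom (add_monoid G) (add_monoid G)"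
  shows "(\<lambda>z. \<phi> z \<oplus> \<psi> z) \<in> hom (add_monoid G) (add_monoid G)"
  using assms by (auto simp: hom_def Pi_iff a_ac)

lemma (in abelian_group) hom_int_multiple:
  assumes "\<phi> \<in> hom (add_monoid G) (add_monoid G)"
  shows "(\<lambda>z. [(k::int)] \<cdot> \<phi> z) \<in> hom (add_monoid G) (add_monoid G)"
  using assms add.int_pow_distrib add.int_pow_closed by (auto simp: hom_def Pi_iff)

text \<open>\<open>T(V)\<close> and \<open>A\<close> are quotient rings with a scalar multiplication
  attached, so ring facts about the quotients have to be carried across the change of
  record.\<close>

lemma ring_extend:
  assumes "ring R" shows "ring (ring.extend R E)"
proof -
  interpret ring R by fact
  have "abelian_group (ring.extend R E)"
    by (rule abelian_groupI) (auto simp: ring.defs a_ac intro: bexI[of _ "\<ominus>\<^bsub>R\<^esub> _"] l_neg)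
  moreover have "monoid (ring.extend R E)"
    by (rule monoidI) (auto simp: ring.defs m_assoc)
  ultimately show ?thesis
    by (intro ringI) (auto simp: ring.defs l_distr r_distr abelian_group_def)
qed

lemma ring_hom_extend: "ring_hom A (ring.extend R E) = ring_hom A R"
  by (simp add: ring_hom_def ring.defs)

lemma ring_extend_simps:
  "carrier (ring.extend R E) = carrier R"
  "x \<otimes>\<^bsub>ring.extend R E\<^esub> y = x \<otimes>\<^bsub>R\<^esub> y"
  "x \<oplus>\<^bsub>ring.extend R E\<^esub> y = x \<oplus>\<^bsub>R\<^esub> y"
  "\<zero>\<^bsub>ring.extend R E\<^esub> = \<zero>\<^bsub>R\<^esub>"
  "\<one>\<^bsub>ring.extend R E\<^esub> = \<one>\<^bsub>R\<^esub>"
  by (simp_all add: ring.defs)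

lemma smult_extend: "c \<odot>\<^bsub>ring.extend R (module.fields f)\<^esub> x = f c x"
  by (simp add: ring.defs module.defs)

text \<open>A homomorphism on all of \<open>C\<close> restricts to the generated subgroup and is
  therefore a candidate in the definition; any other candidate agrees with it by induction on
  \<open>generate\<close>, so the description is unique.\<close>

lemma additive_extension_eq:
  assumes "abelian_group C" "\<phi> \<in> hom (add_monoid C) (add_monoid C)" "g ` S \<subseteq> carrier C" "\<And>s. s \<in> S \<Longrightarrow> \<phi> (g s) = h s"
  "z \<in> generate (add_monoid C) (g ` S)"
  shows "additive_extension C S g h z = \<phi> z"
proof -
  interpret abelian_group C by fact
  let ?G = "subgroup_generated (add_monoid C) (g ` S)"
  have car: "carrier ?G = generate (add_monoid C) (g ` S)"
    using assms(3) by (simp add: carrier_subgroup_generated Int_absorb1)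
  have grp: "group ?G" by simp
  have sub: "carrier ?G \<subseteq> carrier C"
    using add.carrier_subgroup_generated_subset by simp
  have \<phi>: "\<phi> \<in> hom ?G (add_monoid C)"
    using assms(2) sub by (auto simp: hom_def subset_iff)
  have "\<psi> z = \<phi> z" if "\<psi> \<in> hom ?G (add_monoid C)" "\<And>s. s \<in> S \<Longrightarrow> \<psi> (g s) = h s" for \<psi>
  proof -
    interpret p: group_hom ?G "add_monoid C" \<phi> by (intro group_hom.intro group_hom_axioms.intro grp \<phi> a_group)
    interpret s: group_hom ?G "add_monoid C" \<psi> by (intro group_hom.intro group_hom_axioms.intro grp that(1) a_group)
    from assms(5) show ?thesis
    proof induction
      case one show ?case using p.hom_one s.hom_one by simp
    next case (incl x) then show ?case using that(2) assms(4) by auto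
    next case (inv x)
      then have "x \<in> carrier ?G" by (simp add: car generate.incl)
      moreover have "\<psi> x = \<phi> x" using inv that(2) assms(4) by auto
      ultimately show ?case using p.hom_inv[of x] s.hom_inv[of x] add.inv_subgroup_generated[of x "g ` S"] by (simp add: a_inv_def)
    next case (eng x y)
      \<comment> \<open>\<open>generate\<close> takes inverses in \<open>C\<close>,
        \<open>hom_inv\<close> takes them in \<open>?G\<close>; the two coincide.\<close>
      then show ?case using p.hom_mult[of x y] s.hom_mult[of x y] car by simp
    qed
  qed
  then show ?thesis
    unfolding additive_extension_def using \<phi> assms(4) by (intro the_equality) blast+
qed

section \<open>Tensor products over the ground field\<close>

lemma base_field_simps [simp]:
  "carrier base_field = UNIV"
  "c \<otimes>\<^bsub>base_field\<^esub> d = c * d"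
  "c \<oplus>\<^bsub>base_field\<^esub> d = c + d"
  "\<zero>\<^bsub>base_field\<^esub> = 0"
  "\<one>\<^bsub>base_field\<^esub> = 1"
  by (simp_all add: ring_of_type_algebra_def)

locale tensor_factors = M: module base_field M + N: module base_field N
  for M :: "('k::field, 'm, 'c) module_scheme" and N :: "('k, 'n, 'd) module_scheme"
begin

abbreviation "P \<equiv> tensor_product M N"
abbreviation "free_group \<equiv> free_Abelian_group (carrier M \<times> carrier N)"
abbreviation "rel \<equiv> tensor_relations M N"

text \<open>Membership in a free Abelian group is a bound on \<open>keys\<close>; this lemma and the
  next place the relators in its carrier.\<close>

lemma keys_frag_diff_diff: "a \<in> S \<Longrightarrow> b \<in> S \<Longrightarrow> c \<in> S \<Longrightarrow> Poly_Mapping.keys (frag_of a - frag_of b - frag_of c) \<subseteq> S"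
  using keys_diff[of "frag_of a - frag_of b" "frag_of c"] keys_diff[of "frag_of a" "frag_of b"]
  by (auto simp: keys_frag_of)

lemma keys_frag_diff: "a \<in> S \<Longrightarrow> b \<in> S \<Longrightarrow> Poly_Mapping.keys (frag_of a - frag_of b) \<subseteq> S"
  using keys_diff[of "frag_of a" "frag_of b"]
  by (auto simp: keys_frag_of)

lemma relations_subgroup: "subgroup rel free_group"
  unfolding tensor_relations_def
  by (rule group.generate_is_subgroup)
    (safe, simp_all only: group_free_Abelian_group carrier_free_Abelian_group_iff, simp_all add: keys_frag_diff_diff keys_frag_diff)

lemma relations_normal: "rel \<lhd> free_group"
  using comm_group.normal_iff_subgroup[OF abelian_free_Abelian_group] relations_subgroup by blast

text \<open>Only the additive fields of the record are meaningful, so every group-theoretic fact is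
  imported through this identification with a factor group.\<close>

lemma add_monoid_tensor_product: "add_monoid P = free_group Mod rel"
  by (simp add: tensor_product_def FactGroup_def Let_def)

lemma abelian_group_tensor_product: "abelian_group P"
  by (rule comm_group_abelian_groupI, unfold add_monoid_tensor_product)
    (rule comm_group.abelian_FactGroup[OF abelian_free_Abelian_group relations_subgroup])

lemma coset_hom: "(\<lambda>x. rel #>\<^bsub>free_group\<^esub> x) \<in> hom free_group (add_monoid P)"
  unfolding add_monoid_tensor_product by (rule normal.r_coset_hom_Mod) (rule relations_normal)

lemma coset_eq:
  assumes "x \<in> carrier free_group" "y \<in> carrier free_group" "x - y \<in> rel"
  shows "rel #>\<^bsub>free_group\<^esub> x = rel #>\<^bsub>free_group\<^esub> y"
proof -
  have "x \<in> rel #>\<^bsub>free_group\<^esub> y"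
    using assms(3) unfolding r_coset_def by (auto intro!: bexI[of _ "x - y"])
  then show ?thesis
    using group.repr_independence[OF group_free_Abelian_group _ assms(2) relations_subgroup] by metis
qed

lemma pure_tensor_closed [simp, intro]:
  "m \<in> carrier M \<Longrightarrow> n \<in> carrier N \<Longrightarrow> pure_tensor M N m n \<in> carrier P"
  using hom_in_carrier[OF coset_hom, of "frag_of (m, n)"] by (simp add: pure_tensor_def)

lemma pure_tensor_add_left:
  assumes "m \<in> carrier M" "m' \<in> carrier M" "n \<in> carrier N"
  shows "pure_tensor M N (m \<oplus>\<^bsub>M\<^esub> m') n = pure_tensor M N m n \<oplus>\<^bsub>P\<^esub> pure_tensor M N m' n"
proof -
  have "rel #>\<^bsub>free_group\<^esub> frag_of (m \<oplus>\<^bsub>M\<^esub> m', n) = rel #>\<^bsub>free_group\<^esub> (frag_of (m, n) + frag_of (m', n))"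
    using assms keys_add[of "frag_of (m, n)" "frag_of (m', n)"]
    \<comment> \<open>Reversing \<open>diff_diff_eq\<close> brings the difference into the literal
      form of a relator.\<close>
    by (intro coset_eq) (auto simp: diff_diff_eq[symmetric] tensor_relations_def keys_frag_of intro!: generate.incl)
  then show ?thesis
    using hom_mult[OF coset_hom, of "frag_of (m, n)" "frag_of (m', n)"] assms
    by (simp add: pure_tensor_def)
qed

lemma pure_tensor_add_right:
  assumes "m \<in> carrier M" "n \<in> carrier N" "n' \<in> carrier N"
  shows "pure_tensor M N m (n \<oplus>\<^bsub>N\<^esub> n') = pure_tensor M N m n \<oplus>\<^bsub>P\<^esub> pure_tensor M N m n'"
proof -
  have "rel #>\<^bsub>free_group\<^esub> frag_of (m, n \<oplus>\<^bsub>N\<^esub> n') = rel #>\<^bsub>free_group\<^esub> (frag_of (m, n) + frag_of (m, n'))"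
    using assms keys_add[of "frag_of (m, n)" "frag_of (m, n')"]
    by (intro coset_eq) (auto simp: diff_diff_eq[symmetric] tensor_relations_def keys_frag_of intro!: generate.incl)
  then show ?thesis
    using hom_mult[OF coset_hom, of "frag_of (m, n)" "frag_of (m, n')"] assms
    by (simp add: pure_tensor_def)
qed

lemma pure_tensor_smult:
  assumes "m \<in> carrier M" "n \<in> carrier N"
  shows "pure_tensor M N (c \<odot>\<^bsub>M\<^esub> m) n = pure_tensor M N m (c \<odot>\<^bsub>N\<^esub> n)"
  unfolding pure_tensor_def using assms
  by (intro coset_eq) (auto simp: tensor_relations_def intro!: generate.incl)

text \<open>Scalars enter only as the balancing condition on \<open>B\<close>. \<open>B\<close>
  extends to the free Abelian group on pairs, and each of the three kinds of relators is killed by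
  one of the three equations assumed.\<close>

lemma tensor_product_universal:
  assumes "abelian_group C"
    and closed: "\<And>m n. m \<in> carrier M \<Longrightarrow> n \<in> carrier N \<Longrightarrow> B m n \<in> carrier C"
    and add_left: "\<And>m m' n. m \<in> carrier M \<Longrightarrow> m' \<in> carrier M \<Longrightarrow> n \<in> carrier N \<Longrightarrow>
          B (m \<oplus>\<^bsub>M\<^esub> m') n = B m n \<oplus>\<^bsub>C\<^esub> B m' n"
    and add_right: "\<And>m n n'. m \<in> carrier M \<Longrightarrow> n \<in> carrier N \<Longrightarrow> n' \<in> carrier N \<Longrightarrow>
          B m (n \<oplus>\<^bsub>N\<^esub> n') = B m n \<oplus>\<^bsub>C\<^esub> B m n'"
    and smult: "\<And>c m n. m \<in> carrier M \<Longrightarrow> n \<in> carrier N \<Longrightarrow> B (c \<odot>\<^bsub>M\<^esub> m) n = B m (c \<odot>\<^bsub>N\<^esub> n)"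
  obtains \<phi> where "\<phi> \<in> hom (add_monoid P) (add_monoid C)"
    "\<And>m n. m \<in> carrier M \<Longrightarrow> n \<in> carrier N \<Longrightarrow> \<phi> (pure_tensor M N m n) = B m n"
proof -
  interpret C: abelian_group C by fact
  have "(\<lambda>(m, n). B m n) ` (carrier M \<times> carrier N) \<subseteq> carrier (add_monoid C)"
    using closed by auto
  then obtain h where h: "h \<in> hom free_group (add_monoid C)"
    "\<And>x. x \<in> carrier M \<times> carrier N \<Longrightarrow> h (frag_of x) = (\<lambda>(m, n). B m n) x"
    by (rule comm_group.free_Abelian_group_universal[OF C.a_comm_group]) (rule that)
  interpret h: group_hom free_group "add_monoid C" h
    by (simp add: group_hom_def group_hom_axioms_def h(1) C.a_group)
  have h_diff: "h (x - y) = h x \<ominus>\<^bsub>C\<^esub> h y" if "x \<in> carrier free_group" "y \<in> carrier free_group" for x y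
    using h.hom_mult[of x "- y"] h.hom_inv[of y] that by (simp add: C.minus_eq a_inv_def)
  have rel0: "rel \<subseteq> kernel free_group (add_monoid C) h"
    unfolding tensor_relations_def
  proof (rule group.generate_subgroup_incl[OF _ _ h.subgroup_kernel], simp, safe)
    fix m m' n assume "m \<in> carrier M" "m' \<in> carrier M" "n \<in> carrier N"
    then show "frag_of (m \<oplus>\<^bsub>M\<^esub> m', n) - frag_of (m, n) - frag_of (m', n) \<in> kernel free_group (add_monoid C) h"
      by (simp add: kernel_def h_diff h(2) keys_frag_diff_diff keys_frag_diff add_left closed keys_frag_of C.add_minus_minus)
  next
    fix m n n' assume "m \<in> carrier M" "n' \<in> carrier N" "n \<in> carrier N"
    then show "frag_of (m, n \<oplus>\<^bsub>N\<^esub> n') - frag_of (m, n) - frag_of (m, n') \<in> kernel free_group (add_monoid C) h"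
      by (simp add: kernel_def h_diff h(2) keys_frag_diff_diff keys_frag_diff add_right closed keys_frag_of C.add_minus_minus)
  next
    fix c m n assume "m \<in> carrier M" "n \<in> carrier N"
    then show "frag_of (c \<odot>\<^bsub>M\<^esub> m, n) - frag_of (m, c \<odot>\<^bsub>N\<^esub> n) \<in> kernel free_group (add_monoid C) h"
      using M.smult_closed N.smult_closed
      by (simp add: kernel_def h_diff h(2) keys_frag_diff smult closed keys_frag_of C.minus_eq C.r_neg)
  qed
  obtain \<phi> where \<phi>: "\<phi> \<in> hom (free_group Mod rel) (add_monoid C)" "\<And>x. x \<in> carrier free_group \<Longrightarrow> \<phi> (rel #>\<^bsub>free_group\<^esub> x) = h x"
    by (rule h.FactGroup_universal_kernel[OF relations_normal rel0]) (rule that)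
  show thesis
  proof (rule that)
    show "\<phi> \<in> hom (add_monoid P) (add_monoid C)"
      unfolding add_monoid_tensor_product by (rule \<phi>(1))
    show "\<phi> (pure_tensor M N m n) = B m n" if "m \<in> carrier M" "n \<in> carrier N" for m n
      unfolding pure_tensor_def using that by (subst \<phi>(2)) (simp_all add: h(2) keys_frag_of)
  qed
qed

end

section \<open>The tensor algebra\<close>

lemma free_algebra_simps:
  "carrier (free_algebra V) = {p. Poly_Mapping.keys p \<subseteq> lists (carrier V)}"
  "p \<otimes>\<^bsub>free_algebra V\<^esub> q = p * q"
  "p \<oplus>\<^bsub>free_algebra V\<^esub> q = p + q"
  "\<zero>\<^bsub>free_algebra V\<^esub> = 0"
  "\<one>\<^bsub>free_algebra V\<^esub> = 1"
  by (simp_all add: free_algebra_def ring_of_type_algebra_def)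

lemma list_monoid_simps [simp]: "xs + ys = xs @ ys" "(0::'a list) = []"
  by (simp_all add: plus_list_def zero_list_def)

text \<open>The ring laws are inherited from the type of finitely supported functions; the content
  is closure of the support condition, where the words of a product are concatenations of words of
  the factors.\<close>

lemma ring_free_algebra: "ring (free_algebra V)"
proof (rule ringI)
  show "abelian_group (free_algebra V)"
  proof (rule abelian_groupI)
    fix x assume "x \<in> carrier (free_algebra V)"
    then show "\<exists>y\<in>carrier (free_algebra V). y \<oplus>\<^bsub>free_algebra V\<^esub> x = \<zero>\<^bsub>free_algebra V\<^esub>"
      by (intro bexI[of _ "- x"]) (auto simp: free_algebra_simps in_keys_iff)
  next
    fix x y assume "x \<in> carrier (free_algebra V)" "y \<in> carrier (free_algebra V)"
    then show "x \<oplus>\<^bsub>free_algebra V\<^esub> y \<in> carrier (free_algebra V)"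
      using keys_add[of x y] by (auto simp: free_algebra_simps)
  qed (simp_all add: free_algebra_simps add_ac)
  show "monoid (free_algebra V)"
  proof (rule monoidI)
    fix x y assume xy: "x \<in> carrier (free_algebra V)" "y \<in> carrier (free_algebra V)"
    show "x \<otimes>\<^bsub>free_algebra V\<^esub> y \<in> carrier (free_algebra V)"
      unfolding free_algebra_simps
    proof (intro CollectI subsetI)
      fix w assume "w \<in> Poly_Mapping.keys (x * y)"
      then obtain u v where "u \<in> Poly_Mapping.keys x" "v \<in> Poly_Mapping.keys y" "w = u @ v"
        using keys_mult[of x y] by auto
      then show "w \<in> lists (carrier V)"
        using xy by (auto simp: free_algebra_simps)
    qed
  qed (simp_all add: free_algebra_simps mult.assoc)
qed (simp_all add: free_algebra_simps algebra_simps)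

lemma keys_induct [consumes 1, case_names zero single add]:
  fixes p :: "'a \<Rightarrow>\<^sub>0 'b::comm_monoid_add"
  assumes "Poly_Mapping.keys p \<subseteq> S"
    and "P 0"
    and "\<And>w c. w \<in> S \<Longrightarrow> P (Poly_Mapping.single w c)"
    and "\<And>p q. Poly_Mapping.keys p \<subseteq> S \<Longrightarrow> Poly_Mapping.keys q \<subseteq> S \<Longrightarrow> P p \<Longrightarrow> P q \<Longrightarrow> P (p + q)"
  shows "P p"
proof -
  \<comment> \<open>The support bound is proved along with \<open>P\<close>, because the rule for
    sums asks for it on both summands.\<close>
  have "Poly_Mapping.keys (\<Sum>w\<in>K. Poly_Mapping.single w (f w)) \<subseteq> S
      \<and> P (\<Sum>w\<in>K. Poly_Mapping.single w (f w))" if "finite K" "K \<subseteq> S" for K f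
    using that
  proof (induction K)
    case empty then show ?case using assms(2) by simp
  next
    case (insert w K)
    then show ?case
      using keys_add[of "Poly_Mapping.single w (f w)" "\<Sum>w\<in>K. Poly_Mapping.single w (f w)"] assms(3,4)
      by (auto split: if_splits)
  qed
  moreover have "p = (\<Sum>w\<in>Poly_Mapping.keys p. Poly_Mapping.single w (Poly_Mapping.lookup p w))"
    by (rule poly_mapping_eqI)
      (simp add: lookup_sum lookup_single when_def sum.delta' in_keys_iff)
  ultimately show ?thesis using assms(1) by (metis finite_keys)
qed

lemma single_Nil_one: "Poly_Mapping.single [] 1 = (1 :: 'a list \<Rightarrow>\<^sub>0 'b::zero_neq_one)"
  using single_one[where ?'a = "'a list" and ?'b = 'b] by simp

section \<open>The tensor algebra as a ring and as a vector space\<close>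

locale base_field_module = V: module base_field V
  for V :: "('k::field, 'v, 'b) module_scheme"
begin

abbreviation "F \<equiv> free_algebra V"
abbreviation "T \<equiv> tensor_algebra V"
abbreviation "J \<equiv> linearity_ideal V"

sublocale F: ring F by (rule ring_free_algebra)

lemma single_closed [simp]: "w \<in> lists (carrier V) \<Longrightarrow> Poly_Mapping.single w c \<in> carrier F"
  by (simp add: free_algebra_simps)

lemma free_algebra_mult_closed [simp]: "p \<in> carrier F \<Longrightarrow> q \<in> carrier F \<Longrightarrow> p * q \<in> carrier F"
  using F.m_closed[of p q] by (simp add: free_algebra_simps)

lemma free_algebra_add_closed [simp]: "p \<in> carrier F \<Longrightarrow> q \<in> carrier F \<Longrightarrow> p + q \<in> carrier F"
  using F.a_closed[of p q] by (simp add: free_algebra_simps)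

lemma free_algebra_zero_closed [simp]: "0 \<in> carrier F" and free_algebra_one_closed [simp]: "1 \<in> carrier F"
  using F.zero_closed F.one_closed by (simp_all add: free_algebra_simps)

lemma diff_closed [simp]: "p \<in> carrier F \<Longrightarrow> q \<in> carrier F \<Longrightarrow> p - q \<in> carrier F"
  using keys_diff[of p q] by (auto simp: free_algebra_simps)

abbreviation linearity_generators :: "('v list \<Rightarrow>\<^sub>0 'k) set"
  where "linearity_generators \<equiv>
    {Poly_Mapping.single [x \<oplus>\<^bsub>V\<^esub> y] 1 - Poly_Mapping.single [x] 1 - Poly_Mapping.single [y] 1
        | x y. x \<in> carrier V \<and> y \<in> carrier V}
     \<union> {Poly_Mapping.single [c \<odot>\<^bsub>V\<^esub> x] 1 - Poly_Mapping.single [x] c | c x. x \<in> carrier V}"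

lemma generators_closed: "linearity_generators \<subseteq> carrier F"
  using V.smult_closed by (auto intro!: diff_closed)

sublocale J: ideal J F
  unfolding linearity_ideal_def by (rule F.genideal_ideal[OF generators_closed])

lemma generators_subset: "linearity_generators \<subseteq> J"
  unfolding linearity_ideal_def by (rule F.genideal_self[OF generators_closed])

sublocale T: ring T
  unfolding tensor_algebra_def Let_def by (rule ring_extend[OF J.quotient_is_ring])

lemma carrier_tensor_algebra: "carrier T = tensor_class V ` carrier F"
  unfolding tensor_algebra_def Let_def ring_extend_simps
  by (auto simp: FactRing_def A_RCOSETS_def' tensor_class_def)

lemma tensor_class_hom: "tensor_class V \<in> ring_hom F T"
  unfolding tensor_algebra_def Let_def ring_hom_extend tensor_class_def[abs_def]
  by (rule J.rcos_ring_hom)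

lemma tensor_class_closed [simp]: "p \<in> carrier F \<Longrightarrow> tensor_class V p \<in> carrier T"
  by (simp add: carrier_tensor_algebra)

lemma tensor_class_add:
  "p \<in> carrier F \<Longrightarrow> q \<in> carrier F \<Longrightarrow> tensor_class V (p + q) = tensor_class V p \<oplus>\<^bsub>T\<^esub> tensor_class V q"
  using ring_hom_add[OF tensor_class_hom, of p q] by (simp add: free_algebra_simps)

lemma tensor_class_mult:
  "p \<in> carrier F \<Longrightarrow> q \<in> carrier F \<Longrightarrow> tensor_class V (p * q) = tensor_class V p \<otimes>\<^bsub>T\<^esub> tensor_class V q"
  using ring_hom_mult[OF tensor_class_hom, of p q] by (simp add: free_algebra_simps)

lemma tensor_class_one: "tensor_class V 1 = \<one>\<^bsub>T\<^esub>"
  using ring_hom_one[OF tensor_class_hom] by (simp add: free_algebra_simps)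

lemma tensor_class_zero: "tensor_class V 0 = \<zero>\<^bsub>T\<^esub>"
  using ring_hom_zero[OF tensor_class_hom F.ring_axioms T.ring_axioms] by (simp add: free_algebra_simps)

text \<open>Coset equality is phrased with the subtraction of the ring record, the generators of the
  linearity ideal with that of the type class.\<close>

lemma free_algebra_minus: "p \<in> carrier F \<Longrightarrow> q \<in> carrier F \<Longrightarrow> p \<ominus>\<^bsub>F\<^esub> q = p - q"
proof -
  assume *: "p \<in> carrier F" "q \<in> carrier F"
  have "\<ominus>\<^bsub>F\<^esub> q = - q"
    using * diff_closed[of 0 q] F.zero_closed by (intro F.minus_equality) (auto simp: free_algebra_simps)
  then show ?thesis by (simp add: a_minus_def free_algebra_simps)
qed

lemma free_algebra_uminus: "p \<in> carrier F \<Longrightarrow> \<ominus>\<^bsub>F\<^esub> p = 0 - p"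
  using free_algebra_minus[of 0 p] F.l_zero by (simp add: a_minus_def free_algebra_simps)

lemma tensor_class_eq_iff:
  assumes "p \<in> carrier F" "q \<in> carrier F"
  shows "tensor_class V p = tensor_class V q \<longleftrightarrow> p - q \<in> J"
  unfolding tensor_class_def using F.quotient_eq_iff_same_a_r_cos[OF J.ideal_axioms assms] assms
  by (simp add: free_algebra_minus)

lemma smult_tensor_algebra: "c \<odot>\<^bsub>T\<^esub> t = tensor_class V (Poly_Mapping.single [] c) \<otimes>\<^bsub>T\<^esub> t"
  unfolding tensor_algebra_def Let_def smult_extend by (simp add: ring_extend_simps)

sublocale TM: module base_field T
proof (rule moduleI)
  show "cring (base_field :: 'k ring)" by (rule cring_from_type_algebra)
  show "abelian_group T" by (rule T.abelian_group_axioms)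
next
  fix a b x assume "x \<in> carrier T"
  then show "(a \<oplus>\<^bsub>base_field\<^esub> b) \<odot>\<^bsub>T\<^esub> x = a \<odot>\<^bsub>T\<^esub> x \<oplus>\<^bsub>T\<^esub> b \<odot>\<^bsub>T\<^esub> x"
    "(a \<otimes>\<^bsub>base_field\<^esub> b) \<odot>\<^bsub>T\<^esub> x = a \<odot>\<^bsub>T\<^esub> (b \<odot>\<^bsub>T\<^esub> x)"
    by (simp_all add: smult_tensor_algebra single_add tensor_class_add T.l_distr T.m_assoc[symmetric]
         tensor_class_mult[symmetric] mult_single)
next
  fix x assume "x \<in> carrier T"
  then show "\<one>\<^bsub>base_field\<^esub> \<odot>\<^bsub>T\<^esub> x = x"
    by (simp add: smult_tensor_algebra single_Nil_one tensor_class_one)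
qed (simp_all add: smult_tensor_algebra T.r_distr)

lemma tensor_word_closed [simp]: "w \<in> lists (carrier V) \<Longrightarrow> tensor_word V w \<in> carrier T"
  by (simp add: tensor_word_def)

lemma tensor_word_append:
  "u \<in> lists (carrier V) \<Longrightarrow> v \<in> lists (carrier V) \<Longrightarrow>
    tensor_word V (u @ v) = tensor_word V u \<otimes>\<^bsub>T\<^esub> tensor_word V v"
  by (simp add: tensor_word_def tensor_class_mult[symmetric] mult_single)

lemma tensor_class_single:
  "w \<in> lists (carrier V) \<Longrightarrow> tensor_class V (Poly_Mapping.single w c) = c \<odot>\<^bsub>T\<^esub> tensor_word V w"
  by (simp add: smult_tensor_algebra tensor_word_def tensor_class_mult[symmetric] mult_single)

lemma smult_mult_left:
  "s \<in> carrier T \<Longrightarrow> t \<in> carrier T \<Longrightarrow> (c \<odot>\<^bsub>T\<^esub> s) \<otimes>\<^bsub>T\<^esub> t = c \<odot>\<^bsub>T\<^esub> (s \<otimes>\<^bsub>T\<^esub> t)"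
  by (simp add: smult_tensor_algebra T.m_assoc)

text \<open>Scalars act by multiplication from the left with multiples of the empty word. Centrality
  lets them pass a left factor, which is \<open>smult_mult_right\<close>.\<close>

lemma single_Nil_central:
  "p \<in> carrier F \<Longrightarrow> Poly_Mapping.single [] c * p = p * Poly_Mapping.single [] c"
  unfolding free_algebra_simps mem_Collect_eq
  by (induction p rule: keys_induct) (simp_all add: mult_single mult.commute algebra_simps)

lemma smult_mult_right:
  assumes "s \<in> carrier T" "t \<in> carrier T"
  shows "s \<otimes>\<^bsub>T\<^esub> (c \<odot>\<^bsub>T\<^esub> t) = c \<odot>\<^bsub>T\<^esub> (s \<otimes>\<^bsub>T\<^esub> t)"
proof -
  obtain p where p: "p \<in> carrier F" "s = tensor_class V p" using assms(1) carrier_tensor_algebra by auto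
  then have "tensor_class V (Poly_Mapping.single [] c) \<otimes>\<^bsub>T\<^esub> s = s \<otimes>\<^bsub>T\<^esub> tensor_class V (Poly_Mapping.single [] c)"
    by (simp add: tensor_class_mult[symmetric] single_Nil_central)
  then show ?thesis
    using assms by (simp add: smult_tensor_algebra T.m_assoc[symmetric])
qed

lemma tensor_word_add:
  assumes "x \<in> carrier V" "y \<in> carrier V"
  shows "tensor_word V [x \<oplus>\<^bsub>V\<^esub> y] = tensor_word V [x] \<oplus>\<^bsub>T\<^esub> tensor_word V [y]"
proof -
  have "Poly_Mapping.single [x \<oplus>\<^bsub>V\<^esub> y] 1 - (Poly_Mapping.single [x] 1 + Poly_Mapping.single [y] (1::'k)) \<in> J"
    using generators_subset assms by (auto simp: diff_diff_eq[symmetric])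
  then show ?thesis
    using assms F.a_closed[of "Poly_Mapping.single [x] 1" "Poly_Mapping.single [y] 1"]
    by (simp add: tensor_word_def tensor_class_add[symmetric] tensor_class_eq_iff free_algebra_simps)
qed

lemma tensor_word_smult:
  assumes "x \<in> carrier V"
  shows "tensor_word V [c \<odot>\<^bsub>V\<^esub> x] = c \<odot>\<^bsub>T\<^esub> tensor_word V [x]"
proof -
  have "Poly_Mapping.single [c \<odot>\<^bsub>V\<^esub> x] 1 - Poly_Mapping.single [x] (c::'k) \<in> J"
    using generators_subset assms by auto
  then show ?thesis
    using assms V.smult_closed[of c x] tensor_class_single[of "[x]" c]
    by (simp add: tensor_word_def[of V "[c \<odot>\<^bsub>V\<^esub> x]"] tensor_class_eq_iff flip: tensor_class_single)
qed

end

section \<open>Multilinear maps on words\<close>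

text \<open>\<open>C\<close> has no action of \<open>k\<close>, so homogeneity in a letter is
  expressed by moving the scalar to \<open>m\<close>. The words \<open>u\<close> and
  \<open>v\<close> let the varied letter stand at any position.\<close>

locale multilinear_map = base_field_module V + M: module base_field M + C: abelian_group C
  for V :: "('k::field, 'v, 'b) module_scheme"
    and M :: "('k, 'm, 'd) module_scheme"
    and C :: "('c, 'e) ring_scheme" +
  fixes g :: "'m \<Rightarrow> 'v list \<Rightarrow> 'c"
  assumes closed: "m \<in> carrier M \<Longrightarrow> w \<in> lists (carrier V) \<Longrightarrow> g m w \<in> carrier C"
    and add_left: "m \<in> carrier M \<Longrightarrow> m' \<in> carrier M \<Longrightarrow> w \<in> lists (carrier V) \<Longrightarrow>
      g (m \<oplus>\<^bsub>M\<^esub> m') w = g m w \<oplus>\<^bsub>C\<^esub> g m' w"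
    and letter_add: "m \<in> carrier M \<Longrightarrow> u \<in> lists (carrier V) \<Longrightarrow> v \<in> lists (carrier V) \<Longrightarrow>
      x \<in> carrier V \<Longrightarrow> y \<in> carrier V \<Longrightarrow>
      g m (u @ (x \<oplus>\<^bsub>V\<^esub> y) # v) = g m (u @ x # v) \<oplus>\<^bsub>C\<^esub> g m (u @ y # v)"
    and letter_smult: "m \<in> carrier M \<Longrightarrow> u \<in> lists (carrier V) \<Longrightarrow> v \<in> lists (carrier V) \<Longrightarrow>
      x \<in> carrier V \<Longrightarrow> g m (u @ (c \<odot>\<^bsub>V\<^esub> x) # v) = g (c \<odot>\<^bsub>M\<^esub> m) (u @ x # v)"
begin

text \<open>The coefficient of a word goes into \<open>m\<close>, which also works for the empty
  word, where no letter could absorb it.\<close>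

definition extension :: "'m \<Rightarrow> ('v list \<Rightarrow>\<^sub>0 'k) \<Rightarrow> 'c"
  where "extension m p =
    finsum C (\<lambda>w. g (Poly_Mapping.lookup p w \<odot>\<^bsub>M\<^esub> m) w) (Poly_Mapping.keys p)"

lemma g_smult_closed [simp]:
  "m \<in> carrier M \<Longrightarrow> w \<in> lists (carrier V) \<Longrightarrow> g (c \<odot>\<^bsub>M\<^esub> m) w \<in> carrier C"
  using closed M.smult_closed by simp

lemma g_zero:
  assumes "w \<in> lists (carrier V)"
  shows "g \<zero>\<^bsub>M\<^esub> w = \<zero>\<^bsub>C\<^esub>"
  using add_left[of "\<zero>\<^bsub>M\<^esub>" "\<zero>\<^bsub>M\<^esub>" w] closed[of "\<zero>\<^bsub>M\<^esub>" w] assms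
  by (intro C.idempotent_zero) simp_all

lemma g_smult_zero:
  assumes "m \<in> carrier M" "w \<in> lists (carrier V)"
  shows "g (0 \<odot>\<^bsub>M\<^esub> m) w = \<zero>\<^bsub>C\<^esub>"
  using M.smult_l_null[OF assms(1)] g_zero[OF assms(2)] by simp

text \<open>A word with coefficient 0 contributes nothing. Additivity in \<open>p\<close> relies on
  this: \<open>p\<close>, \<open>q\<close> and \<open>p + q\<close> have different supports, and a
  common index set is needed to add the sums termwise.\<close>

lemma extension_superset:
  assumes "m \<in> carrier M" "Poly_Mapping.keys p \<subseteq> K" "finite K" "K \<subseteq> lists (carrier V)"
  shows "extension m p = finsum C (\<lambda>w. g (Poly_Mapping.lookup p w \<odot>\<^bsub>M\<^esub> m) w) K"
  unfolding extension_def using assms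
  by (intro C.add.finprod_mono_neutral_cong_left)
    (auto simp: in_keys_iff subset_iff g_smult_zero intro!: g_smult_closed)

lemma extension_closed [simp]:
  "m \<in> carrier M \<Longrightarrow> p \<in> carrier F \<Longrightarrow> extension m p \<in> carrier C"
  unfolding extension_def free_algebra_simps
  by (intro C.finsum_closed) (auto intro!: g_smult_closed)

lemma extension_add_right:
  assumes "m \<in> carrier M" "p \<in> carrier F" "q \<in> carrier F"
  shows "extension m (p + q) = extension m p \<oplus>\<^bsub>C\<^esub> extension m q"
proof -
  let ?K = "Poly_Mapping.keys p \<union> Poly_Mapping.keys q"
  have K: "finite ?K" "?K \<subseteq> lists (carrier V)" "Poly_Mapping.keys (p + q) \<subseteq> ?K"
    using assms(2,3) keys_add[of p q] by (auto simp: free_algebra_simps)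
  have "extension m (p + q) = finsum C (\<lambda>w. g (Poly_Mapping.lookup p w \<odot>\<^bsub>M\<^esub> m) w
      \<oplus>\<^bsub>C\<^esub> g (Poly_Mapping.lookup q w \<odot>\<^bsub>M\<^esub> m) w) ?K"
    unfolding extension_superset[OF assms(1) K(3,1,2)]
    using K(2) assms(1) M.smult_l_distr
    by (intro C.finsum_cong') (auto simp: lookup_add subset_iff add_left[symmetric] intro!: C.a_closed g_smult_closed)
  also have "\<dots> = extension m p \<oplus>\<^bsub>C\<^esub> extension m q"
    using K(2) assms(1)
    by (subst (1 2) extension_superset[OF assms(1) _ K(1,2)])
      (auto intro!: C.finsum_addf g_smult_closed)
  finally show ?thesis .
qed

lemma extension_add_left:
  assumes "m \<in> carrier M" "m' \<in> carrier M" "p \<in> carrier F"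
  shows "extension (m \<oplus>\<^bsub>M\<^esub> m') p = extension m p \<oplus>\<^bsub>C\<^esub> extension m' p"
proof -
  have K: "Poly_Mapping.keys p \<subseteq> lists (carrier V)" using assms(3) by (simp add: free_algebra_simps)
  have "extension (m \<oplus>\<^bsub>M\<^esub> m') p = finsum C (\<lambda>w. g (Poly_Mapping.lookup p w \<odot>\<^bsub>M\<^esub> m) w
      \<oplus>\<^bsub>C\<^esub> g (Poly_Mapping.lookup p w \<odot>\<^bsub>M\<^esub> m') w) (Poly_Mapping.keys p)"
    unfolding extension_def using K assms(1,2) M.smult_r_distr M.smult_closed
    by (intro C.finsum_cong') (auto simp: subset_iff add_left[symmetric] intro!: C.a_closed g_smult_closed)
  also have "\<dots> = extension m p \<oplus>\<^bsub>C\<^esub> extension m' p"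
    unfolding extension_def using K assms by (intro C.finsum_addf) (auto intro!: g_smult_closed)
  finally show ?thesis .
qed

lemma extension_single:
  assumes "m \<in> carrier M" "w \<in> lists (carrier V)"
  shows "extension m (Poly_Mapping.single w c) = g (c \<odot>\<^bsub>M\<^esub> m) w"
  using extension_superset[OF assms(1), of "Poly_Mapping.single w c" "{w}"] assms
  by (simp add: C.finsum_insert)

lemma extension_zero: "m \<in> carrier M \<Longrightarrow> extension m 0 = \<zero>\<^bsub>C\<^esub>"
  by (simp add: extension_def)

lemma extension_diff:
  assumes "m \<in> carrier M" "p \<in> carrier F" "q \<in> carrier F"
  shows "extension m (p - q) = extension m p \<ominus>\<^bsub>C\<^esub> extension m q"
  using extension_add_right[OF assms(1) diff_closed[OF assms(2,3)] assms(3)]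
    diff_closed[OF assms(2,3)] assms
  by (simp add: C.minus_eq C.a_assoc C.r_neg)

text \<open>This becomes the balancing condition when \<open>extension\<close> is passed to the
  tensor product over \<open>k\<close>.\<close>

lemma extension_smult:
  assumes "m \<in> carrier M" "p \<in> carrier F"
  shows "extension m (Poly_Mapping.single [] c * p) = extension (c \<odot>\<^bsub>M\<^esub> m) p"
proof -
  have cl: "Poly_Mapping.single [] c * p \<in> carrier F" if "p \<in> carrier F" for p
    using F.m_closed[of "Poly_Mapping.single [] c" p] that by (simp add: free_algebra_simps)
  show ?thesis
    using assms(2) unfolding free_algebra_simps mem_Collect_eq
  proof (induction p rule: keys_induct)
    case zero
    then show ?case using assms(1) M.smult_closed by (simp add: extension_zero)
  next
    case (single w d)
    then show ?case using assms(1) M.smult_closed[of c m] M.smult_assoc1[of d c m]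
      by (simp add: extension_single mult_single mult.commute)
  next
    case (add p q)
    then show ?case using assms(1) M.smult_closed[of c m] cl[of p] cl[of q]
      by (simp add: distrib_left extension_add_right free_algebra_simps)
  qed
qed

text \<open>Quantifying over factors on both sides makes this set a two-sided ideal by construction.\<close>

definition kernel_ideal :: "('v list \<Rightarrow>\<^sub>0 'k) set"
  where "kernel_ideal = {p \<in> carrier F. \<forall>m \<in> carrier M. \<forall>a \<in> carrier F. \<forall>b \<in> carrier F.
    extension m (a * p * b) = \<zero>\<^bsub>C\<^esub>}"

lemma kernel_ideal: "ideal kernel_ideal F"
proof (rule idealI)
  show "ring F" by (rule F.ring_axioms)
  show "subgroup kernel_ideal (add_monoid F)"
  proof (rule F.add.subgroupI)
    show "kernel_ideal \<subseteq> carrier F" by (auto simp: kernel_ideal_def)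
    have "0 \<in> kernel_ideal" by (simp add: kernel_ideal_def extension_zero)
    then show "kernel_ideal \<noteq> {}" by blast
    show "\<ominus>\<^bsub>F\<^esub> p \<in> kernel_ideal" if "p \<in> kernel_ideal" for p
      using that unfolding kernel_ideal_def
      by (simp add: free_algebra_uminus right_diff_distrib left_diff_distrib extension_diff extension_zero C.minus_eq del: diff_0)
    show "p \<oplus>\<^bsub>F\<^esub> q \<in> kernel_ideal" if "p \<in> kernel_ideal" "q \<in> kernel_ideal" for p q
      using that unfolding kernel_ideal_def
      by (simp add: distrib_left distrib_right extension_add_right free_algebra_simps(3))
  qed
  fix p x assume p: "p \<in> kernel_ideal" and x: "x \<in> carrier F"
  show "x \<otimes>\<^bsub>F\<^esub> p \<in> kernel_ideal"
    using p x unfolding kernel_ideal_def free_algebra_simps(2)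
    by (auto simp: mult.assoc[symmetric])
  show "p \<otimes>\<^bsub>F\<^esub> x \<in> kernel_ideal"
    using p x unfolding kernel_ideal_def free_algebra_simps(2)
    by (auto simp: mult.assoc)
qed

text \<open>The product with two outer factors is additive in each of them, so monomials suffice.
  The left factor is generalised first, with the right one still a monomial.\<close>

lemma kernel_idealI:
  assumes "p \<in> carrier F"
    and "\<And>m u v c d. m \<in> carrier M \<Longrightarrow> u \<in> lists (carrier V) \<Longrightarrow> v \<in> lists (carrier V) \<Longrightarrow>
      extension m (Poly_Mapping.single u c * p * Poly_Mapping.single v d) = \<zero>\<^bsub>C\<^esub>"
  shows "p \<in> kernel_ideal"
proof -
  have "extension m (a * p * Poly_Mapping.single v d) = \<zero>\<^bsub>C\<^esub>"
    if "a \<in> carrier F" and m: "m \<in> carrier M" and v: "v \<in> lists (carrier V)" for a m v d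
    using that(1) unfolding free_algebra_simps mem_Collect_eq
  proof (induction a rule: keys_induct)
    case (add a b)
    then have "a \<in> carrier F" "b \<in> carrier F" by (simp_all add: free_algebra_simps)
    with add(3,4) m v assms(1) show ?case
      by (simp add: distrib_left distrib_right extension_add_right)
  qed (use assms(2) m v in \<open>simp_all add: extension_zero\<close>)
  note 1 = this
  have "extension m (a * p * b) = \<zero>\<^bsub>C\<^esub>"
    if "b \<in> carrier F" and m: "m \<in> carrier M" and a: "a \<in> carrier F" for a b m
    using that(1) unfolding free_algebra_simps mem_Collect_eq
  proof (induction b rule: keys_induct)
    case (add b c)
    then have "b \<in> carrier F" "c \<in> carrier F" by (simp_all add: free_algebra_simps)
    with add(3,4) m a assms(1) show ?case
      by (simp add: distrib_left distrib_right extension_add_right)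
  qed (use 1 m a in \<open>simp_all add: extension_zero\<close>)
  then show ?thesis using assms(1) by (simp add: kernel_ideal_def)
qed

text \<open>By minimality only the generators of the ideal matter. Between two monomials a generator
  turns into an instance of \<open>letter_add\<close> or \<open>letter_smult\<close>, the outer
  words being its prefix and suffix.\<close>

lemma linearity_ideal_subset: "J \<subseteq> kernel_ideal"
  unfolding linearity_ideal_def
proof (rule F.genideal_minimal[OF kernel_ideal], safe)
  fix x y assume xy: "x \<in> carrier V" "y \<in> carrier V"
  then have "x \<oplus>\<^bsub>V\<^esub> y \<in> carrier V" by simp
  with xy show "Poly_Mapping.single [x \<oplus>\<^bsub>V\<^esub> y] 1 - Poly_Mapping.single [x] 1 - Poly_Mapping.single [y] 1 \<in> kernel_ideal"
    by (intro kernel_idealI)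
      (simp_all add: right_diff_distrib left_diff_distrib mult_single extension_diff extension_single
        letter_add C.add_minus_minus)
next
  fix c :: 'k and x assume x: "x \<in> carrier V"
  then have "c \<odot>\<^bsub>V\<^esub> x \<in> carrier V" using V.smult_closed by simp
  with x show "Poly_Mapping.single [c \<odot>\<^bsub>V\<^esub> x] 1 - Poly_Mapping.single [x] c \<in> kernel_ideal"
    by (intro kernel_idealI)
      (use M.smult_closed M.smult_assoc1[symmetric] in \<open>simp_all add: right_diff_distrib left_diff_distrib mult_single extension_diff extension_single
        letter_smult C.minus_eq C.r_neg mult_ac\<close>)
qed

text \<open>Independence of the representative, so that \<open>extension m\<close> descends to
  \<open>T(V)\<close>. Taking the unit for both outer factors in \<open>kernel_ideal\<close>
  recovers the value at \<open>p - q\<close> itself.\<close>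

lemma extension_cong:
  assumes "p \<in> carrier F" "q \<in> carrier F" "tensor_class V p = tensor_class V q" "m \<in> carrier M"
  shows "extension m p = extension m q"
proof -
  have "p - q \<in> kernel_ideal"
    using linearity_ideal_subset assms tensor_class_eq_iff by blast
  then have "extension m (1 * (p - q) * 1) = \<zero>\<^bsub>C\<^esub>"
    using assms(4) free_algebra_one_closed unfolding kernel_ideal_def by blast
  then show ?thesis
    using assms extension_add_right[of m "p - q" q] by simp
qed

sublocale MT: tensor_factors M T ..

lemma universal:
  obtains \<phi> where "\<phi> \<in> hom (add_monoid (tensor_product M T)) (add_monoid C)"
    "\<And>m w. m \<in> carrier M \<Longrightarrow> w \<in> lists (carrier V) \<Longrightarrow> \<phi> (pure_tensor M T m (tensor_word V w)) = g m w"
proof -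
  \<comment> \<open>The choice \<open>rep\<close> need not be additive or linear; by
    \<open>extension_cong\<close> the values of \<open>extension\<close> at representatives
    nevertheless are.\<close>
  define rep where "rep t = (SOME p. p \<in> carrier F \<and> tensor_class V p = t)" for t
  have rep: "rep t \<in> carrier F" "tensor_class V (rep t) = t" if "t \<in> carrier T" for t
  proof -
    have "\<exists>p. p \<in> carrier F \<and> tensor_class V p = t" using that unfolding carrier_tensor_algebra by blast
    from someI_ex[OF this] show "rep t \<in> carrier F" "tensor_class V (rep t) = t" by (simp_all add: rep_def)
  qed
  have ext: "extension m (rep t) = extension m p"
    if "m \<in> carrier M" "p \<in> carrier F" "t = tensor_class V p" for m p t
    using that by (intro extension_cong) (simp_all add: rep)
  have add_T: "extension m (rep (s \<oplus>\<^bsub>T\<^esub> t)) = extension m (rep s) \<oplus>\<^bsub>C\<^esub> extension m (rep t)"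
    if m: "m \<in> carrier M" and s: "s \<in> carrier T" and t: "t \<in> carrier T" for m s t
  proof -
    have "extension m (rep (s \<oplus>\<^bsub>T\<^esub> t)) = extension m (rep s + rep t)"
      by (rule ext) (simp_all add: m s t rep tensor_class_add)
    then show ?thesis by (simp add: extension_add_right m s t rep(1))
  qed
  have smult: "extension (c \<odot>\<^bsub>M\<^esub> m) (rep t) = extension m (rep (c \<odot>\<^bsub>T\<^esub> t))"
    if m: "m \<in> carrier M" and t: "t \<in> carrier T" for c m t
  proof -
    have "extension m (rep (c \<odot>\<^bsub>T\<^esub> t)) = extension m (Poly_Mapping.single [] c * rep t)"
      by (rule ext) (simp_all add: m t rep tensor_class_mult smult_tensor_algebra)
    then show ?thesis by (simp add: extension_smult m t rep(1))
  qed
  obtain \<phi> where hom: "\<phi> \<in> hom (add_monoid (tensor_product M T)) (add_monoid C)"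
    and \<phi>: "\<And>m t. m \<in> carrier M \<Longrightarrow> t \<in> carrier T \<Longrightarrow> \<phi> (pure_tensor M T m t) = extension m (rep t)"
  proof (rule MT.tensor_product_universal[OF C.abelian_group_axioms, of "\<lambda>m t. extension m (rep t)"])
    show "extension m (rep t) \<in> carrier C" if "m \<in> carrier M" "t \<in> carrier T" for m t
      by (rule extension_closed[OF that(1) rep(1)[OF that(2)]])
    show "extension (m \<oplus>\<^bsub>M\<^esub> m') (rep t) = extension m (rep t) \<oplus>\<^bsub>C\<^esub> extension m' (rep t)"
      if "m \<in> carrier M" "m' \<in> carrier M" "t \<in> carrier T" for m m' t
      by (rule extension_add_left[OF that(1,2) rep(1)[OF that(3)]])
  qed (rule add_T smult that, assumption+)+
  have "\<phi> (pure_tensor M T m (tensor_word V w)) = g m w" if m: "m \<in> carrier M" and w: "w \<in> lists (carrier V)" for m w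
  proof -
    have "extension m (rep (tensor_word V w)) = extension m (Poly_Mapping.single w 1)"
      by (rule ext) (simp_all add: m w tensor_word_def)
    also have "\<dots> = g m w"
      using M.smult_one[OF m] by (simp add: extension_single m w)
    finally show ?thesis by (simp add: \<phi> m w)
  qed
  with hom show thesis by (rule that)
qed

end

section \<open>Quadratic algebras and Koszul chains\<close>

context base_field_module
begin

lemma homogeneous_induct [consumes 1, case_names zero single add]:
  assumes "t \<in> tensor_class V ` {p \<in> carrier F. Poly_Mapping.keys p \<subseteq> S}"
    and "P \<zero>\<^bsub>T\<^esub>"
    and "\<And>c w. w \<in> S \<Longrightarrow> w \<in> lists (carrier V) \<Longrightarrow> P (c \<odot>\<^bsub>T\<^esub> tensor_word V w)"
    and "\<And>s t. s \<in> carrier T \<Longrightarrow> t \<in> carrier T \<Longrightarrow> P s \<Longrightarrow> P t \<Longrightarrow> P (s \<oplus>\<^bsub>T\<^esub> t)"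
  shows "P t"
proof -
  obtain p where p: "t = tensor_class V p" "Poly_Mapping.keys p \<subseteq> S \<inter> lists (carrier V)"
    using assms(1) by (auto simp: free_algebra_simps)
  have "P (tensor_class V p)"
    using p(2)
  proof (induction p rule: keys_induct)
    case (add p q)
    then show ?case using assms(4) by (simp add: tensor_class_add free_algebra_simps)
  qed (use assms(2,3) in \<open>simp_all add: tensor_class_zero tensor_class_single\<close>)
  with p(1) show ?thesis by simp
qed

lemma tensor_power_alt:
  "tensor_power V n = tensor_class V ` {p \<in> carrier F. Poly_Mapping.keys p \<subseteq> {w. length w = n}}"
  unfolding tensor_power_def by (rule arg_cong[where f = "image _"]) auto

lemma tensor_power_induct [consumes 1, case_names zero single add]:
  assumes "t \<in> tensor_power V n"
    and "P \<zero>\<^bsub>T\<^esub>"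
    and "\<And>c w. length w = n \<Longrightarrow> w \<in> lists (carrier V) \<Longrightarrow> P (c \<odot>\<^bsub>T\<^esub> tensor_word V w)"
    and "\<And>s t. s \<in> carrier T \<Longrightarrow> t \<in> carrier T \<Longrightarrow> P s \<Longrightarrow> P t \<Longrightarrow> P (s \<oplus>\<^bsub>T\<^esub> t)"
  shows "P t"
  using assms(1)[unfolded tensor_power_alt] by (rule homogeneous_induct) (use assms(2-4) in auto)

lemma tensor_algebra_induct [consumes 1, case_names zero single add]:
  assumes "t \<in> carrier T"
    and "P \<zero>\<^bsub>T\<^esub>"
    and "\<And>c w. w \<in> lists (carrier V) \<Longrightarrow> P (c \<odot>\<^bsub>T\<^esub> tensor_word V w)"
    and "\<And>s t. s \<in> carrier T \<Longrightarrow> t \<in> carrier T \<Longrightarrow> P s \<Longrightarrow> P t \<Longrightarrow> P (s \<oplus>\<^bsub>T\<^esub> t)"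
  shows "P t"
  using assms by (intro homogeneous_induct[of t UNIV P]) (auto simp: carrier_tensor_algebra)

lemma tensor_power_closed: "tensor_power V n \<subseteq> carrier T"
  unfolding tensor_power_def carrier_tensor_algebra by auto

lemma tensor_power_zero: "\<zero>\<^bsub>T\<^esub> \<in> tensor_power V n"
  unfolding tensor_power_alt using F.zero_closed
  by (intro image_eqI[of _ _ 0]) (simp_all add: tensor_class_zero free_algebra_simps)

lemma tensor_power_add:
  "s \<in> tensor_power V n \<Longrightarrow> t \<in> tensor_power V n \<Longrightarrow> s \<oplus>\<^bsub>T\<^esub> t \<in> tensor_power V n"
  unfolding tensor_power_alt
proof (safe, rule image_eqI)
  fix p q assume pq: "p \<in> carrier F" "q \<in> carrier F"
    "Poly_Mapping.keys p \<subseteq> {w. length w = n}" "Poly_Mapping.keys q \<subseteq> {w. length w = n}"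
  show "tensor_class V p \<oplus>\<^bsub>T\<^esub> tensor_class V q = tensor_class V (p + q)"
    using pq by (simp add: tensor_class_add)
  show "p + q \<in> {p \<in> carrier F. Poly_Mapping.keys p \<subseteq> {w. length w = n}}"
    using pq F.a_closed[OF pq(1,2)] keys_add[of p q] by (auto simp: free_algebra_simps)
qed

lemma tensor_power_mult:
  "s \<in> tensor_power V m \<Longrightarrow> t \<in> tensor_power V n \<Longrightarrow> s \<otimes>\<^bsub>T\<^esub> t \<in> tensor_power V (m + n)"
  unfolding tensor_power_alt
proof (safe, rule image_eqI)
  fix p q assume pq: "p \<in> carrier F" "q \<in> carrier F"
    "Poly_Mapping.keys p \<subseteq> {w. length w = m}" "Poly_Mapping.keys q \<subseteq> {w. length w = n}"
  show "tensor_class V p \<otimes>\<^bsub>T\<^esub> tensor_class V q = tensor_class V (p * q)"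
    using pq by (simp add: tensor_class_mult)
  have "length w = m + n" if "w \<in> Poly_Mapping.keys (p * q)" for w
    using that pq(3,4) keys_mult[of p q] by fastforce
  then show "p * q \<in> {p \<in> carrier F. Poly_Mapping.keys p \<subseteq> {w. length w = m + n}}"
    using F.m_closed[OF pq(1,2)] by (auto simp: free_algebra_simps(2))
qed

text \<open>A scalar acts as a factor of degree 0.\<close>

lemma tensor_power_smult:
  "t \<in> tensor_power V n \<Longrightarrow> c \<odot>\<^bsub>T\<^esub> t \<in> tensor_power V n"
  using tensor_power_mult[of "tensor_class V (Poly_Mapping.single [] c)" 0 t n]
  unfolding smult_tensor_algebra by (auto simp: tensor_power_def)

lemma tensor_power_minus: "t \<in> tensor_power V n \<Longrightarrow> \<ominus>\<^bsub>T\<^esub> t \<in> tensor_power V n"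
  using tensor_power_smult[of t n "- 1"] subsetD[OF tensor_power_closed, of t n] TM.smult_l_minus[of 1 t]
    TM.smult_l_distr[of "-1" 1 t] TM.smult_one[of t] TM.smult_l_null[of t]
    T.minus_equality[of "(-1) \<odot>\<^bsub>T\<^esub> t" t] TM.smult_closed[of "-1" t]
  by simp

lemma subgroup_tensor_power: "subgroup (tensor_power V n) (add_monoid T)"
  by (rule T.add.subgroupI)
    (use tensor_power_closed tensor_power_minus tensor_power_add tensor_power_zero[of n] in \<open>auto simp del: ex_in_conv\<close>)

lemma tensor_word_in_power:
  "w \<in> lists (carrier V) \<Longrightarrow> tensor_word V w \<in> tensor_power V (length w)"
  unfolding tensor_word_def tensor_power_def by (intro imageI) simp

text \<open>The cap products with \<open>e_A\<close> are prescribed on all of \<open>W_1\<close>,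
  the contractions only on single letters. The two match because the linearity relations collapse a
  linear combination of letters into one letter.\<close>

lemma tensor_power_one:
  assumes "w \<in> tensor_power V 1"
  obtains x where "x \<in> carrier V" "w = tensor_word V [x]"
proof -
  have "\<exists>x \<in> carrier V. w = tensor_word V [x]"
    using assms
  proof (induction w rule: tensor_power_induct)
    case zero
    show ?case
      \<comment> \<open>The one-letter word of the zero vector is a nonzero polynomial; its class
        vanishes because the zero vector is 0 times itself.\<close>
      using tensor_word_smult[of "\<zero>\<^bsub>V\<^esub>" 0] V.smult_l_null[of "\<zero>\<^bsub>V\<^esub>"]
        TM.smult_l_null[of "tensor_word V [\<zero>\<^bsub>V\<^esub>]"]
      by (intro bexI[of _ "\<zero>\<^bsub>V\<^esub>"]) simp_all
  next
    case (single c w)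
    then obtain x where "w = [x]" "x \<in> carrier V" by (auto simp: length_Suc_conv)
    then show ?case using tensor_word_smult[of x c] V.smult_closed[of c x] by force
  next
    case (add s t)
    then show ?case using tensor_word_add V.a_closed by metis
  qed
  then show thesis using that by blast
qed

lemma tensor_word_letter_add:
  assumes "u \<in> lists (carrier V)" "v \<in> lists (carrier V)" "x \<in> carrier V" "y \<in> carrier V"
  shows "tensor_word V (u @ (x \<oplus>\<^bsub>V\<^esub> y) # v) = tensor_word V (u @ x # v) \<oplus>\<^bsub>T\<^esub> tensor_word V (u @ y # v)"
  using assms
  by (simp add: tensor_word_append[of u] tensor_word_append[of "[_]" v, simplified]
      tensor_word_add T.l_distr T.r_distr)

lemma tensor_word_letter_smult:
  assumes "u \<in> lists (carrier V)" "v \<in> lists (carrier V)" "x \<in> carrier V"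
  shows "tensor_word V (u @ (c \<odot>\<^bsub>V\<^esub> x) # v) = c \<odot>\<^bsub>T\<^esub> tensor_word V (u @ x # v)"
  using assms V.smult_closed[of c x]
  by (simp add: tensor_word_append[of u] tensor_word_append[of "[_]" v, simplified]
      tensor_word_smult smult_mult_left smult_mult_right)

end

section \<open>The quadratic algebra and the degree of Koszul spaces\<close>

locale quadratic_data = base_field_module V
  for V :: "('k::field, 'v, 'b) module_scheme" +
  fixes R :: "('v list \<Rightarrow>\<^sub>0 'k) set set"
  assumes relations: "quadratic_relations V R"
begin

abbreviation "A \<equiv> quadratic_algebra V R"

lemma R_subset: "R \<subseteq> tensor_power V 2" "R \<subseteq> carrier T"
  using relations tensor_power_closed unfolding quadratic_relations_def by blast+

lemma relations_ideal: "ideal (Idl\<^bsub>T\<^esub> R) T"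
  by (rule T.genideal_ideal[OF R_subset(2)])

lemma algebra_class_hom: "algebra_class V R \<in> ring_hom T A"
  unfolding quadratic_algebra_def Let_def ring_hom_extend algebra_class_def[abs_def]
  by (rule ideal.rcos_ring_hom[OF relations_ideal])

lemma ring_A: "ring A"
  unfolding quadratic_algebra_def Let_def
  by (rule ring_extend[OF ideal.quotient_is_ring[OF relations_ideal]])

lemma algebra_class_closed [simp]: "t \<in> carrier T \<Longrightarrow> algebra_class V R t \<in> carrier A"
  by (rule ring_hom_closed[OF algebra_class_hom])

lemma smult_one_A: "c \<odot>\<^bsub>A\<^esub> \<one>\<^bsub>A\<^esub> = algebra_class V R (c \<odot>\<^bsub>T\<^esub> \<one>\<^bsub>T\<^esub>)"
proof -
  have "c \<odot>\<^bsub>A\<^esub> \<one>\<^bsub>A\<^esub> = algebra_class V R (c \<odot>\<^bsub>T\<^esub> \<one>\<^bsub>T\<^esub>) \<otimes>\<^bsub>A\<^esub> \<one>\<^bsub>A\<^esub>"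
    unfolding quadratic_algebra_def Let_def smult_extend ring_extend_simps by simp
  then show ?thesis
    using TM.smult_closed[of c "\<one>\<^bsub>T\<^esub>"] by (simp add: monoid.r_one[OF ring.is_monoid[OF ring_A]])
qed

abbreviation e :: "'v \<Rightarrow> ('v list \<Rightarrow>\<^sub>0 'k) set set"
  where "e x \<equiv> algebra_class V R (tensor_word V [x])"

lemma e_add:
  "x \<in> carrier V \<Longrightarrow> y \<in> carrier V \<Longrightarrow> e (x \<oplus>\<^bsub>V\<^esub> y) = e x \<oplus>\<^bsub>A\<^esub> e y"
  by (simp add: tensor_word_add ring_hom_add[OF algebra_class_hom])

text \<open>The bimodule laws know scalars only as multiples of the unit of \<open>A\<close>, hence
  this form of homogeneity.\<close>

lemma e_smult: "x \<in> carrier V \<Longrightarrow> e (c \<odot>\<^bsub>V\<^esub> x) = (c \<odot>\<^bsub>A\<^esub> \<one>\<^bsub>A\<^esub>) \<otimes>\<^bsub>A\<^esub> e x"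
  using TM.smult_closed[of c "\<one>\<^bsub>T\<^esub>"]
  by (simp add: smult_one_A tensor_word_smult ring_hom_mult[OF algebra_class_hom, symmetric] smult_mult_left)

lemma koszul_space_subset: "koszul_space V R q \<subseteq> tensor_power V q"
proof (cases "q < 2")
  case False
  \<comment> \<open>One member of the intersection is enough: the relation in the first two
    positions.\<close>
  then have "(0, q - 2) \<in> {(i, j). i + 2 + j = q}" by auto
  then have "koszul_space V R q \<subseteq> relation_space V R 0 (q - 2)"
    using False unfolding koszul_space_def by auto
  also have "\<dots> \<subseteq> tensor_power V q"
    unfolding relation_space_def
  proof (rule T.add.generate_subgroup_incl[OF _ subgroup_tensor_power], safe)
    fix u r v assume "u \<in> tensor_power V 0" "r \<in> R" "v \<in> tensor_power V (q - 2)"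
    then show "u \<otimes>\<^bsub>T\<^esub> r \<otimes>\<^bsub>T\<^esub> v \<in> tensor_power V q"
      using tensor_power_mult[OF tensor_power_mult[of u 0 r 2], of v "q - 2"] R_subset(1)
        le_add_diff_inverse[of 2 q] False
      by auto
  qed
  finally show ?thesis .
qed (simp add: koszul_space_def)

lemma koszul_space_one: "koszul_space V R 1 = tensor_power V 1"
  by (simp add: koszul_space_def)

end


section \<open>Contracting the first and the last letter against the coefficient\<close>

locale koszul_coefficients = quadratic_data V R + bimodule: algebra_bimodule "quadratic_algebra V R" M lact ract
  for V :: "('k::field, 'v, 'b) module_scheme"
    and R :: "('v list \<Rightarrow>\<^sub>0 'k) set set"
    and M :: "('k, 'm, 'd) module_scheme"
    and lact ract
begin

sublocale MT: tensor_factors M T ..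

abbreviation "C \<equiv> chain_group V M"

sublocale C: abelian_group C by (rule MT.abelian_group_tensor_product)

lemma lact_e_closed [simp]: "m \<in> carrier M \<Longrightarrow> x \<in> carrier V \<Longrightarrow> lact (e x) m \<in> carrier M"
  by (rule bimodule.lact_closed) simp_all

lemma ract_e_closed [simp]: "m \<in> carrier M \<Longrightarrow> x \<in> carrier V \<Longrightarrow> ract m (e x) \<in> carrier M"
  by (rule bimodule.ract_closed) simp_all

lemma scalar_closed: "c \<odot>\<^bsub>A\<^esub> \<one>\<^bsub>A\<^esub> \<in> carrier A"
  using TM.smult_closed[of c "\<one>\<^bsub>T\<^esub>"] by (simp add: smult_one_A)

text \<open>Linearity over \<open>k\<close> comes from the commuting actions: the scalar is
  rewritten as an action from the right, which passes the left action of \<open>a\<close>. The next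
  lemma is the mirror image.\<close>

lemma lact_smult:
  "a \<in> carrier A \<Longrightarrow> m \<in> carrier M \<Longrightarrow> lact a (c \<odot>\<^bsub>M\<^esub> m) = c \<odot>\<^bsub>M\<^esub> lact a m"
  by (metis bimodule.lact_closed bimodule.lact_ract bimodule.ract_scalar scalar_closed)

lemma ract_smult:
  "a \<in> carrier A \<Longrightarrow> m \<in> carrier M \<Longrightarrow> ract (c \<odot>\<^bsub>M\<^esub> m) a = c \<odot>\<^bsub>M\<^esub> ract m a"
  by (metis bimodule.ract_closed bimodule.lact_ract bimodule.lact_scalar scalar_closed)

lemma lact_e_smult: "m \<in> carrier M \<Longrightarrow> x \<in> carrier V \<Longrightarrow> lact (e (c \<odot>\<^bsub>V\<^esub> x)) m = lact (e x) (c \<odot>\<^bsub>M\<^esub> m)"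
  by (simp add: e_smult bimodule.lact_mult scalar_closed bimodule.lact_scalar lact_smult)

lemma ract_e_smult: "m \<in> carrier M \<Longrightarrow> x \<in> carrier V \<Longrightarrow> ract m (e (c \<odot>\<^bsub>V\<^esub> x)) = ract (c \<odot>\<^bsub>M\<^esub> m) (e x)"
  by (simp add: e_smult bimodule.ract_mult scalar_closed bimodule.ract_scalar)

abbreviation "ct \<equiv> chain_tensor V M"

lemma pure_tensor_zero: "m \<in> carrier M \<Longrightarrow> ct m \<zero>\<^bsub>T\<^esub> = \<zero>\<^bsub>C\<^esub>"
  using MT.pure_tensor_add_right[of m "\<zero>\<^bsub>T\<^esub>" "\<zero>\<^bsub>T\<^esub>"] MT.pure_tensor_closed[of m "\<zero>\<^bsub>T\<^esub>"]
  by (intro C.idempotent_zero) simp_all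

text \<open>The map comes from the universal property, applied to the function that strips the first
  letter and lets it act on \<open>m\<close>. The formula is stated for every \<open>t\<close>, not
  just for words, since the cap products leave an arbitrary tensor of degree \<open>q - 1\<close>
  behind.\<close>

lemma ex_right_contraction:
  "\<exists>\<phi> \<in> hom (add_monoid C) (add_monoid C). \<forall>m \<in> carrier M. \<forall>x \<in> carrier V. \<forall>t \<in> carrier T.
    \<phi> (ct m (tensor_word V [x] \<otimes>\<^bsub>T\<^esub> t)) = ct (ract m (e x)) t"
proof -
  let ?g = "\<lambda>m w. case w of [] \<Rightarrow> \<zero>\<^bsub>C\<^esub> | x # w \<Rightarrow> ct (ract m (e x)) (tensor_word V w)"
  interpret multilinear_map V M C ?g
  proof
    fix m w assume "m \<in> carrier M" "w \<in> lists (carrier V)"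
    then show "?g m w \<in> carrier C" by (cases w) auto
  next
    fix m m' w assume "m \<in> carrier M" "m' \<in> carrier M" "w \<in> lists (carrier V)"
    then show "?g (m \<oplus>\<^bsub>M\<^esub> m') w = ?g m w \<oplus>\<^bsub>C\<^esub> ?g m' w"
      by (cases w) (auto simp: bimodule.ract_add_left MT.pure_tensor_add_left)
  next
    fix m u v x y assume "m \<in> carrier M" "u \<in> lists (carrier V)" "v \<in> lists (carrier V)"
      "x \<in> carrier V" "y \<in> carrier V"
    then show "?g m (u @ (x \<oplus>\<^bsub>V\<^esub> y) # v) = ?g m (u @ x # v) \<oplus>\<^bsub>C\<^esub> ?g m (u @ y # v)"
      \<comment> \<open>For empty \<open>u\<close> the varied letter is the acting one, and
        linearity of the action applies; otherwise it stays in the remaining word.\<close>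
      by (cases u) (auto simp: e_add bimodule.ract_add_right MT.pure_tensor_add_left
          tensor_word_letter_add MT.pure_tensor_add_right)
  next
    fix m u v x c assume "m \<in> carrier M" "u \<in> lists (carrier V)" "v \<in> lists (carrier V)" "x \<in> carrier V"
    then show "?g m (u @ (c \<odot>\<^bsub>V\<^esub> x) # v) = ?g (c \<odot>\<^bsub>M\<^esub> m) (u @ x # v)"
      by (cases u) (auto simp: ract_e_smult tensor_word_letter_smult ract_smult MT.pure_tensor_smult)
  qed
  obtain \<phi> where \<phi>: "\<phi> \<in> hom (add_monoid C) (add_monoid C)"
    "\<And>m w. m \<in> carrier M \<Longrightarrow> w \<in> lists (carrier V) \<Longrightarrow> \<phi> (ct m (tensor_word V w)) = ?g m w"
    by (rule universal) (rule that)
  have \<phi>_add: "\<phi> (y \<oplus>\<^bsub>C\<^esub> z) = \<phi> y \<oplus>\<^bsub>C\<^esub> \<phi> z" if "y \<in> carrier C" "z \<in> carrier C" for y z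
    using hom_mult[OF \<phi>(1)] that by simp
  have \<phi>_zero: "\<phi> \<zero>\<^bsub>C\<^esub> = \<zero>\<^bsub>C\<^esub>"
    using hom_one[OF \<phi>(1) C.a_group C.a_group] by simp
  have "\<phi> (ct m (tensor_word V [x] \<otimes>\<^bsub>T\<^esub> t)) = ct (ract m (e x)) t"
    if m: "m \<in> carrier M" and x: "x \<in> carrier V" and t: "t \<in> carrier T" for m x t
    using t
  proof (induction t rule: tensor_algebra_induct)
    case zero
    then show ?case using m x by (simp add: pure_tensor_zero \<phi>_zero)
  next
    case (single c w)
    then show ?case
      \<comment> \<open>The scalar is moved from \<open>t\<close> to \<open>m\<close>, because the
        values of \<open>\<phi>\<close> are known on words only.\<close>
      using m x \<phi>(2)[of "c \<odot>\<^bsub>M\<^esub> m" "x # w"] tensor_word_append[of "[x]" w] bimodule.M.smult_closed[of c m]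
      by (simp add: smult_mult_right MT.pure_tensor_smult[symmetric] ract_smult)
  next
    case (add s t)
    then show ?case using m x
      by (simp add: T.r_distr MT.pure_tensor_add_right \<phi>_add)
  qed
  with \<phi>(1) show ?thesis by blast
qed

text \<open>Mirror image of \<open>ex_right_contraction\<close>: words are split at their end, and
  the position of the varied letter is now decided by whether \<open>v\<close> is empty.\<close>

lemma ex_left_contraction:
  "\<exists>\<phi> \<in> hom (add_monoid C) (add_monoid C). \<forall>m \<in> carrier M. \<forall>x \<in> carrier V. \<forall>t \<in> carrier T.
    \<phi> (ct m (t \<otimes>\<^bsub>T\<^esub> tensor_word V [x])) = ct (lact (e x) m) t"
proof -
  let ?g = "\<lambda>m w. if w = [] then \<zero>\<^bsub>C\<^esub> else ct (lact (e (last w)) m) (tensor_word V (butlast w))"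
  interpret multilinear_map V M C ?g
  proof
    fix m w assume "m \<in> carrier M" "w \<in> lists (carrier V)"
    then show "?g m w \<in> carrier C" by (cases w rule: rev_cases) auto
  next
    fix m m' w assume "m \<in> carrier M" "m' \<in> carrier M" "w \<in> lists (carrier V)"
    then show "?g (m \<oplus>\<^bsub>M\<^esub> m') w = ?g m w \<oplus>\<^bsub>C\<^esub> ?g m' w"
      by (cases w rule: rev_cases) (auto simp: bimodule.lact_add_right MT.pure_tensor_add_left)
  next
    fix m u v x y assume "m \<in> carrier M" "u \<in> lists (carrier V)" "v \<in> lists (carrier V)"
      "x \<in> carrier V" "y \<in> carrier V"
    then show "?g m (u @ (x \<oplus>\<^bsub>V\<^esub> y) # v) = ?g m (u @ x # v) \<oplus>\<^bsub>C\<^esub> ?g m (u @ y # v)"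
      by (cases v rule: rev_cases) (auto simp: e_add bimodule.lact_add_left MT.pure_tensor_add_left butlast_append
          tensor_word_letter_add MT.pure_tensor_add_right)
  next
    fix m u v x c assume "m \<in> carrier M" "u \<in> lists (carrier V)" "v \<in> lists (carrier V)" "x \<in> carrier V"
    then show "?g m (u @ (c \<odot>\<^bsub>V\<^esub> x) # v) = ?g (c \<odot>\<^bsub>M\<^esub> m) (u @ x # v)"
      by (cases v rule: rev_cases) (auto simp: lact_e_smult tensor_word_letter_smult lact_smult MT.pure_tensor_smult butlast_append)
  qed
  obtain \<phi> where \<phi>: "\<phi> \<in> hom (add_monoid C) (add_monoid C)"
    "\<And>m w. m \<in> carrier M \<Longrightarrow> w \<in> lists (carrier V) \<Longrightarrow> \<phi> (ct m (tensor_word V w)) = ?g m w"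
    by (rule universal) (rule that)
  have \<phi>_add: "\<phi> (y \<oplus>\<^bsub>C\<^esub> z) = \<phi> y \<oplus>\<^bsub>C\<^esub> \<phi> z" if "y \<in> carrier C" "z \<in> carrier C" for y z
    using hom_mult[OF \<phi>(1)] that by simp
  have \<phi>_zero: "\<phi> \<zero>\<^bsub>C\<^esub> = \<zero>\<^bsub>C\<^esub>"
    using hom_one[OF \<phi>(1) C.a_group C.a_group] by simp
  have "\<phi> (ct m (t \<otimes>\<^bsub>T\<^esub> tensor_word V [x])) = ct (lact (e x) m) t"
    if m: "m \<in> carrier M" and x: "x \<in> carrier V" and t: "t \<in> carrier T" for m x t
    using t
  proof (induction t rule: tensor_algebra_induct)
    case zero
    then show ?case using m x by (simp add: pure_tensor_zero \<phi>_zero)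
  next
    case (single c w)
    then show ?case
      using m x \<phi>(2)[of "c \<odot>\<^bsub>M\<^esub> m" "w @ [x]"] tensor_word_append[of w "[x]"] bimodule.M.smult_closed[of c m]
      by (simp add: smult_mult_left MT.pure_tensor_smult[symmetric] lact_smult)
  next
    case (add s t)
    then show ?case using m x
      by (simp add: T.l_distr MT.pure_tensor_add_right \<phi>_add)
  qed
  with \<phi>(1) show ?thesis by blast
qed

section \<open>Generating Koszul chains by words\<close>

definition words :: "nat \<Rightarrow> ('m \<times> 'v list) set"
  where "words q = {(m, w). m \<in> carrier M \<and> w \<in> lists (carrier V) \<and> length w = q}"

text \<open>Only a subgroup is generated, not a linear span; a scalar in front of a word is absorbed
  into \<open>m\<close>, which gives a generator again.\<close>

lemma pure_tensor_span:
  assumes "m \<in> carrier M" "t \<in> tensor_power V q"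
  shows "ct m t \<in> generate (add_monoid C) ((\<lambda>(m, w). ct m (tensor_word V w)) ` words q)"
  using assms(2)
proof (induction t rule: tensor_power_induct)
  case zero
  then show ?case
    using generate.one[of "add_monoid C"] assms(1) by (simp add: pure_tensor_zero)
next
  case (single c w)
  then show ?case
    using assms(1) bimodule.M.smult_closed[of c m]
    by (intro generate.incl image_eqI[of _ _ "(c \<odot>\<^bsub>M\<^esub> m, w)"]) (auto simp: words_def MT.pure_tensor_smult)
next
  case (add s t)
  then show ?case
    using generate.eng[of _ "add_monoid C"] assms(1) by (simp add: MT.pure_tensor_add_right)
qed

lemma words_closed: "(\<lambda>(m, w). ct m (tensor_word V w)) ` words q \<subseteq> carrier C"
proof safe
  fix m w assume "(m, w) \<in> words q"
  then show "ct m (tensor_word V w) \<in> carrier C"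
    unfolding words_def by (intro MT.pure_tensor_closed tensor_word_closed) simp_all
qed

text \<open>The words need not lie in \<open>W_q\<close>. The larger subgroup is used because its
  generators can be split letter by letter.\<close>

lemma koszul_chains_subset:
  "koszul_chains V R M q \<subseteq> generate (add_monoid C) ((\<lambda>(m, w). ct m (tensor_word V w)) ` words q)"
  unfolding koszul_chains_def
proof (rule C.add.generate_subgroup_incl[OF _ C.add.generate_is_subgroup])
  show "{ct m w |m w. m \<in> carrier M \<and> w \<in> koszul_space V R q}
      \<subseteq> generate (add_monoid C) ((\<lambda>(m, w). ct m (tensor_word V w)) ` words q)"
    using pure_tensor_span koszul_space_subset by blast
qed (simp add: words_closed)

text \<open>Common reduction for both caps and the differential: the candidate must take the
  prescribed values on \<open>S\<close>, and \<open>S\<close> must cover the words so that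
  \<open>z\<close> lies in the generated subgroup.\<close>

lemma additive_extension_chain:
  assumes "\<phi> \<in> hom (add_monoid C) (add_monoid C)"
    and "\<And>s. s \<in> S \<Longrightarrow> h s \<in> carrier C" "\<And>s. s \<in> S \<Longrightarrow> \<phi> (h s) = h' s"
    and "(\<lambda>(m, w). ct m (tensor_word V w)) ` words q \<subseteq> h ` S"
    and "z \<in> koszul_chains V R M q"
  shows "additive_extension C S h h' z = \<phi> z"
proof (rule additive_extension_eq)
  show "abelian_group C" by (rule C.abelian_group_axioms)
  show "h ` S \<subseteq> carrier C" using assms(2) by auto
  show "z \<in> generate (add_monoid C) (h ` S)"
    using C.add.mono_generate[OF assms(4)] koszul_chains_subset assms(5) by blast
qed (use assms(1,3) in simp_all)

theorem cap_bracket_fundamental: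
  assumes z: "z \<in> koszul_chains V R M q"
  shows "koszul_cap_bracket V R M lact ract 1 (fundamental_cochain V R) q z
    = \<ominus>\<^bsub>C\<^esub> koszul_differential V R M lact ract q z"
proof (cases "q = 0")
  \<comment> \<open>In degree 0 both caps vanish because \<open>q < 1\<close>, and the differential
    vanishes by definition.\<close>
  case True
  then show ?thesis
    by (simp add: koszul_cap_bracket_def koszul_cap_left_def koszul_cap_right_def koszul_differential_def C.minus_eq)
next
  case False
  then obtain n where q: "q = Suc n" by (cases q) auto
  obtain \<rho> where \<rho>: "\<rho> \<in> hom (add_monoid C) (add_monoid C)"
    "\<And>m x t. m \<in> carrier M \<Longrightarrow> x \<in> carrier V \<Longrightarrow> t \<in> carrier T \<Longrightarrow>
      \<rho> (ct m (tensor_word V [x] \<otimes>\<^bsub>T\<^esub> t)) = ct (ract m (e x)) t"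
    using ex_right_contraction by blast
  obtain \<kappa> where \<kappa>: "\<kappa> \<in> hom (add_monoid C) (add_monoid C)"
    "\<And>m x t. m \<in> carrier M \<Longrightarrow> x \<in> carrier V \<Longrightarrow> t \<in> carrier T \<Longrightarrow>
      \<kappa> (ct m (t \<otimes>\<^bsub>T\<^esub> tensor_word V [x])) = ct (lact (e x) m) t"
    using ex_left_contraction by blast
  have zC: "z \<in> carrier C"
    using C.add.generate_in_carrier[OF _ subsetD[OF koszul_chains_subset z]] words_closed by simp
  have word_Cons: "tensor_word V (x # w) = tensor_word V [x] \<otimes>\<^bsub>T\<^esub> tensor_word V w"
    if "x \<in> carrier V" "w \<in> lists (carrier V)" for x w
    using tensor_word_append[of "[x]" w] that by simp
  have word_snoc: "tensor_word V (w @ [x]) = tensor_word V w \<otimes>\<^bsub>T\<^esub> tensor_word V [x]"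
    if "x \<in> carrier V" "w \<in> lists (carrier V)" for x w
    using tensor_word_append[of w "[x]"] that by simp
  have power_T: "u \<in> carrier T" if "u \<in> tensor_power V k" for u k
    using tensor_power_closed that by blast
  have not_less: "\<not> q < 1" using False by simp
  have left: "koszul_cap_left V R M lact 1 (fundamental_cochain V R) q z = [((-1::int) ^ ((q - 1) * 1))] \<cdot>\<^bsub>C\<^esub> \<kappa> z"
    unfolding koszul_cap_left_def if_not_P[OF not_less]
  proof (rule additive_extension_chain[where \<phi> = "\<lambda>z. [((-1::int) ^ ((q - 1) * 1))] \<cdot>\<^bsub>C\<^esub> \<kappa> z", OF _ _ _ _ z])
    show "(\<lambda>z. [((-1::int) ^ ((q - 1) * 1))] \<cdot>\<^bsub>C\<^esub> \<kappa> z) \<in> hom (add_monoid C) (add_monoid C)"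
      by (rule C.hom_int_multiple[OF \<kappa>(1)])
  next
    fix s assume "s \<in> {(m, u, w). m \<in> carrier M \<and> u \<in> tensor_power V (q - 1) \<and> w \<in> koszul_space V R 1}"
    then obtain m u w where muw: "s = (m, u, w)" "m \<in> carrier M" "u \<in> tensor_power V (q - 1)" "w \<in> koszul_space V R 1"
      by auto
    \<comment> \<open>Only after \<open>w\<close> is presented as a single letter does the formula
      for \<open>\<kappa>\<close> apply.\<close>
    obtain x where x: "x \<in> carrier V" "w = tensor_word V [x]"
      using muw(4) unfolding koszul_space_one by (rule tensor_power_one)
    note s = muw[unfolded x(2)] x(1)
    show "(case s of (m, u, w) \<Rightarrow> ct m (u \<otimes>\<^bsub>T\<^esub> w)) \<in> carrier C"
      using s power_T by auto
    show "[((-1::int) ^ ((q - 1) * 1))] \<cdot>\<^bsub>C\<^esub> \<kappa> (case s of (m, u, w) \<Rightarrow> ct m (u \<otimes>\<^bsub>T\<^esub> w)) =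
      (case s of (m, u, w) \<Rightarrow> [((-1::int) ^ ((q - 1) * 1))] \<cdot>\<^bsub>C\<^esub> ct (lact (fundamental_cochain V R w) m) u)"
      using s power_T by (simp add: \<kappa>(2) fundamental_cochain_def)
  next
    show "(\<lambda>(m, w). ct m (tensor_word V w)) ` words q \<subseteq> (\<lambda>(m, u, w). ct m (u \<otimes>\<^bsub>T\<^esub> w)) `
      {(m, u, w). m \<in> carrier M \<and> u \<in> tensor_power V (q - 1) \<and> w \<in> koszul_space V R 1}"
    proof safe
      fix m w assume "(m, w) \<in> words q"
      \<comment> \<open>As \<open>q\<close> is positive, a word splits off its last letter, which
        exhibits it as a product on which the left cap is prescribed.\<close>
      then obtain u x where w: "w = u @ [x]" "m \<in> carrier M" "u \<in> lists (carrier V)" "x \<in> carrier V" "length u = q - 1"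
        using False unfolding words_def by (cases w rule: rev_cases) auto
      then show "ct m (tensor_word V w) \<in> (\<lambda>(m, u, w). ct m (u \<otimes>\<^bsub>T\<^esub> w)) `
        {(m, u, w). m \<in> carrier M \<and> u \<in> tensor_power V (q - 1) \<and> w \<in> koszul_space V R 1}"
        using tensor_word_in_power[of u] tensor_word_in_power[of "[x]"] koszul_space_one
        by (intro image_eqI[of _ _ "(m, tensor_word V u, tensor_word V [x])"]) (auto simp: word_snoc)
    qed
  qed
  have right: "koszul_cap_right V R M ract 1 (fundamental_cochain V R) q z = [((-1::int) ^ (1 * q))] \<cdot>\<^bsub>C\<^esub> \<rho> z"
    unfolding koszul_cap_right_def if_not_P[OF not_less]
  proof (rule additive_extension_chain[where \<phi> = "\<lambda>z. [((-1::int) ^ (1 * q))] \<cdot>\<^bsub>C\<^esub> \<rho> z", OF _ _ _ _ z])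
    show "(\<lambda>z. [((-1::int) ^ (1 * q))] \<cdot>\<^bsub>C\<^esub> \<rho> z) \<in> hom (add_monoid C) (add_monoid C)"
      by (rule C.hom_int_multiple[OF \<rho>(1)])
  next
    fix s assume "s \<in> {(m, w, u). m \<in> carrier M \<and> w \<in> koszul_space V R 1 \<and> u \<in> tensor_power V (q - 1)}"
    then obtain m u w where muw: "s = (m, w, u)" "m \<in> carrier M" "u \<in> tensor_power V (q - 1)" "w \<in> koszul_space V R 1"
      by auto
    obtain x where x: "x \<in> carrier V" "w = tensor_word V [x]"
      using muw(4) unfolding koszul_space_one by (rule tensor_power_one)
    note s = muw[unfolded x(2)] x(1)
    show "(case s of (m, w, u) \<Rightarrow> ct m (w \<otimes>\<^bsub>T\<^esub> u)) \<in> carrier C"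
      using s power_T by auto
    show "[((-1::int) ^ (1 * q))] \<cdot>\<^bsub>C\<^esub> \<rho> (case s of (m, w, u) \<Rightarrow> ct m (w \<otimes>\<^bsub>T\<^esub> u)) =
      (case s of (m, w, u) \<Rightarrow> [((-1::int) ^ (1 * q))] \<cdot>\<^bsub>C\<^esub> ct (ract m (fundamental_cochain V R w)) u)"
      using s power_T by (simp add: \<rho>(2) fundamental_cochain_def)
  next
    show "(\<lambda>(m, w). ct m (tensor_word V w)) ` words q \<subseteq> (\<lambda>(m, w, u). ct m (w \<otimes>\<^bsub>T\<^esub> u)) `
      {(m, w, u). m \<in> carrier M \<and> w \<in> koszul_space V R 1 \<and> u \<in> tensor_power V (q - 1)}"
    proof safe
      fix m w assume "(m, w) \<in> words q"
      then obtain u x where w: "w = x # u" "m \<in> carrier M" "u \<in> lists (carrier V)" "x \<in> carrier V" "length u = q - 1"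
        using False unfolding words_def by (cases w) auto
      then show "ct m (tensor_word V w) \<in> (\<lambda>(m, w, u). ct m (w \<otimes>\<^bsub>T\<^esub> u)) `
        {(m, w, u). m \<in> carrier M \<and> w \<in> koszul_space V R 1 \<and> u \<in> tensor_power V (q - 1)}"
        using tensor_word_in_power[of u] tensor_word_in_power[of "[x]"] koszul_space_one
        by (intro image_eqI[of _ _ "(m, tensor_word V [x], tensor_word V u)"]) (auto simp: word_Cons[of x u])
    qed
  qed
  have differential: "koszul_differential V R M lact ract q z = \<rho> z \<oplus>\<^bsub>C\<^esub> [((-1::int) ^ q)] \<cdot>\<^bsub>C\<^esub> \<kappa> z"
    unfolding koszul_differential_def if_not_P[OF False]
  proof (rule additive_extension_chain[where \<phi> = "\<lambda>z. \<rho> z \<oplus>\<^bsub>C\<^esub> [((-1::int) ^ q)] \<cdot>\<^bsub>C\<^esub> \<kappa> z", OF _ _ _ _ z])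
    show "(\<lambda>z. \<rho> z \<oplus>\<^bsub>C\<^esub> [((-1::int) ^ q)] \<cdot>\<^bsub>C\<^esub> \<kappa> z) \<in> hom (add_monoid C) (add_monoid C)"
      by (intro C.hom_add \<rho>(1) C.hom_int_multiple[OF \<kappa>(1)])
  next
    fix s assume "s \<in> {(m, xs). m \<in> carrier M \<and> xs \<in> lists (carrier V) \<and> length xs = q}"
    then obtain m w where mw: "s = (m, w)" "m \<in> carrier M" "w \<in> lists (carrier V)" "length w = q"
      by blast
    then have "w \<noteq> []" using False by auto
    note s = mw(1-3) this
    show "(case s of (m, xs) \<Rightarrow> ct m (tensor_word V xs)) \<in> carrier C" using s by simp
    have "\<rho> (ct m (tensor_word V w)) = ct (ract m (e (hd w))) (tensor_word V (tl w))"
    proof -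
      obtain x u where "w = x # u" using s(4) by (cases w) auto
      then show ?thesis using s(2,3) word_Cons[of x u] by (simp add: \<rho>(2))
    qed
    moreover have "\<kappa> (ct m (tensor_word V w)) = ct (lact (e (last w)) m) (tensor_word V (butlast w))"
      using s by (cases w rule: rev_cases) (auto simp: word_snoc \<kappa>(2))
    ultimately show "\<rho> (case s of (m, xs) \<Rightarrow> ct m (tensor_word V xs)) \<oplus>\<^bsub>C\<^esub>
        [((-1::int) ^ q)] \<cdot>\<^bsub>C\<^esub> \<kappa> (case s of (m, xs) \<Rightarrow> ct m (tensor_word V xs)) =
      (case s of (m, xs) \<Rightarrow> ct (ract m (e (hd xs))) (tensor_word V (tl xs)) \<oplus>\<^bsub>C\<^esub>
        [((-1::int) ^ q)] \<cdot>\<^bsub>C\<^esub> ct (lact (e (last xs)) m) (tensor_word V (butlast xs)))"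
      using s(1) by simp
  qed (simp add: words_def)
  have "\<rho> z \<in> carrier C" "\<kappa> z \<in> carrier C"
    using hom_in_carrier[OF \<rho>(1)] hom_in_carrier[OF \<kappa>(1)] zC by simp_all
  then show ?thesis
    unfolding koszul_cap_bracket_def left right differential unfolding q
    \<comment> \<open>The sign inside the right cap and the sign in the bracket are both
      \<open>(-1)^q\<close> and cancel, leaving \<open>(-1)^n \<kappa> z - \<rho> z\<close>. Since
      \<open>q = n + 1\<close>, this is the negative of
      \<open>\<rho> z + (-1)^q \<kappa> z\<close>.\<close>
    by (cases "even n") (simp_all add: C.minus_eq C.add.int_pow_neg C.minus_add C.a_comm)
qed

end

theorem theorem4p4:
  fixes V :: "('k::field, 'v) module"
    and R :: "('v list \<Rightarrow>\<^sub>0 'k) set set"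
    and M :: "('k, 'm) module"
    and lact :: "('v list \<Rightarrow>\<^sub>0 'k) set set \<Rightarrow> 'm \<Rightarrow> 'm"
    and ract :: "'m \<Rightarrow> ('v list \<Rightarrow>\<^sub>0 'k) set set \<Rightarrow> 'm"
    and q :: nat
    and z :: "('m \<times> ('v list \<Rightarrow>\<^sub>0 'k) set \<Rightarrow>\<^sub>0 int) set"
  assumes "module base_field V"
    and "quadratic_relations V R"
    and "algebra_bimodule (quadratic_algebra V R) M lact ract"
    and "z \<in> koszul_chains V R M q"
  shows "koszul_cap_bracket V R M lact ract 1 (fundamental_cochain V R) q z
    = \<ominus>\<^bsub>chain_group V M\<^esub> koszul_differential V R M lact ract q z"
proof -
  interpret koszul_coefficients V R M lact ract
    using assms(1-3) by (simp add: koszul_coefficients_def quadratic_data_def quadratic_data_axioms_def base_field_module_def)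
  show ?thesis by (rule cap_bracket_fundamental[OF assms(4)])
qed

end
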